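(* Let $A\ge 0$, $T>0$ and let $\Omega$ be a bounded smooth strictly pseudoconvex domain of $\mathbb{C}^n$. Let $\varphi,f$ be smooth functions in $\bar\Omega\times[0,T]$ and let $u_0$ be a plurisubharmonic function in a neighbourhood of $\bar\Omega$ such that $u_0(z)=\varphi(z,0)$ for every $z\in\partial\Omega$. If there is $a\in\Omega$ such that the Lelong number of $u_0$ at $a$ is positive, then there is no $u\in C^\infty(\bar\Omega\times(0,T))$ satisfying $$\begin{cases}u(\cdot,t)\in SPSH(\bar\Omega)&\forall t\in(0,T),\\ \dot u=\log\det(u_{\alpha\bar\beta})-Au+f(z,t)&\text{on }\bar\Omega\times(0,T),\\ u=\varphi&\text{on }\partial\Omega\times(0,T),\\ u(\cdot,t)\to u_0\ \text{ in }L^1&\text{as }t\searrow0.\end{cases}$$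
   Context: A bounded smooth strictly pseudoconvex domain is a bounded domain $\Omega=\{\rho<0\}$ with smooth boundary, where $\rho$ is a smooth strictly plurisubharmonic function on a bounded neighbourhood of $\bar\Omega$. Notation: $\dot u=\partial u/\partial t$, $u_{\alpha\bar\beta}=\partial^2u/\partial z_\alpha\partial\bar z_\beta$. $u(\cdot,t)\in SPSH(\bar\Omega)$ means that the smooth function $u(\cdot,t)$ is strictly plurisubharmonic up to the boundary, i.e. its complex Hessian is positive definite at every point of $\bar\Omega$. The Lelong number of $u_0$ at $a$ is $\nu_{u_0}(a)=\lim_{r\to0}\frac{\sup_{|z-a|<r}u_0(z)}{\log r}$. *)

theory Defs
  imports "HOL-Analysis.Analysis"
begin

section \<open>Smooth functions\<close>

fun Ck_on :: "nat \<Rightarrow> 'a::real_normed_vector set \<Rightarrow> ('a \<Rightarrow> real) \<Rightarrow> bool" where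
  "Ck_on 0 S g \<longleftrightarrow> continuous_on S g"
| "Ck_on (Suc k) S g \<longleftrightarrow>
     (\<forall>x\<in>S. g differentiable (at x)) \<and>
     (\<forall>v. Ck_on k S (\<lambda>x. frechet_derivative g (at x) v))"

text \<open>Meaningful for open \<open>S\<close> only.\<close>

definition smooth_on :: "'a::real_normed_vector set \<Rightarrow> ('a \<Rightarrow> real) \<Rightarrow> bool" where
  "smooth_on S g \<longleftrightarrow> (\<forall>k. Ck_on k S g)"

text \<open>A smooth function on a set \<open>S\<close> that need not be open is the restriction to \<open>S\<close> of a function
  that is smooth on an open neighbourhood of \<open>S\<close>. Functions being total in HOL, it is represented by
  such an extension. If \<open>S\<close> is contained in the closure of its interior, as are \<open>closure \<Omega> \<times> {0..T}\<close>
  and \<open>closure \<Omega> \<times> {0<..<T}\<close> for open \<open>\<Omega>\<close> and \<open>T > 0\<close>, then all derivatives at points of \<open>S\<close> are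
  determined by the values on \<open>S\<close>.\<close>

definition C_infinity :: "'a::real_normed_vector set \<Rightarrow> ('a \<Rightarrow> real) \<Rightarrow> bool" where
  "C_infinity S g \<longleftrightarrow> (\<exists>W. open W \<and> S \<subseteq> W \<and> smooth_on W g)"

section \<open>The complex Hessian and strictly plurisubharmonic functions\<close>

definition d_z :: "'n \<Rightarrow> (complex^'n \<Rightarrow> complex) \<Rightarrow> complex^'n \<Rightarrow> complex" where
  "d_z \<alpha> g z = (frechet_derivative g (at z) (axis \<alpha> 1)
                 - \<i> * frechet_derivative g (at z) (axis \<alpha> \<i>)) / 2"

definition d_zbar :: "'n \<Rightarrow> (complex^'n \<Rightarrow> complex) \<Rightarrow> complex^'n \<Rightarrow> complex" where
  "d_zbar \<beta> g z = (frechet_derivative g (at z) (axis \<beta> 1)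
                    + \<i> * frechet_derivative g (at z) (axis \<beta> \<i>)) / 2"

definition complex_hessian :: "(complex^'n \<Rightarrow> real) \<Rightarrow> complex^'n \<Rightarrow> complex^'n^'n" where
  "complex_hessian u z = (\<chi> \<alpha> \<beta>. d_z \<alpha> (d_zbar \<beta> (\<lambda>w. complex_of_real (u w))) z)"

definition positive_definite :: "complex^'n^'n \<Rightarrow> bool" where
  "positive_definite H \<longleftrightarrow>
     (\<forall>w. w \<noteq> 0 \<longrightarrow> (\<Sum>\<alpha>\<in>UNIV. \<Sum>\<beta>\<in>UNIV. H $ \<alpha> $ \<beta> * w $ \<alpha> * cnj (w $ \<beta>)) \<in> \<real> \<and>
        0 < Re (\<Sum>\<alpha>\<in>UNIV. \<Sum>\<beta>\<in>UNIV. H $ \<alpha> $ \<beta> * w $ \<alpha> * cnj (w $ \<beta>)))"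

definition SPSH :: "(complex^'n) set \<Rightarrow> (complex^'n \<Rightarrow> real) \<Rightarrow> bool" where
  "SPSH S u \<longleftrightarrow> C_infinity S u \<and> (\<forall>z\<in>S. positive_definite (complex_hessian u z))"

section \<open>Strictly pseudoconvex domains\<close>

definition smooth_boundary :: "'a::real_normed_vector set \<Rightarrow> bool" where
  "smooth_boundary \<Omega> \<longleftrightarrow>
     (\<forall>p\<in>frontier \<Omega>. \<exists>V r. open V \<and> p \<in> V \<and> smooth_on V r \<and>
        (\<exists>v. frechet_derivative r (at p) v \<noteq> 0) \<and> \<Omega> \<inter> V = {z\<in>V. r z < 0})"

definition strictly_pseudoconvex_domain :: "(complex^'n) set \<Rightarrow> bool" where
  "strictly_pseudoconvex_domain \<Omega> \<longleftrightarrow>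
     \<Omega> \<noteq> {} \<and> open \<Omega> \<and> connected \<Omega> \<and> bounded \<Omega> \<and> smooth_boundary \<Omega> \<and>
     (\<exists>U \<rho>. open U \<and> bounded U \<and> closure \<Omega> \<subseteq> U \<and> SPSH U \<rho> \<and> \<Omega> = {z\<in>U. \<rho> z < 0})"

section \<open>Plurisubharmonic functions and Lelong numbers\<close>

text \<open>The integral of an extended real function as the integral of its positive part minus the
  integral of its negative part (\<open>e2ennreal\<close> sends negative numbers to 0). Upper semicontinuous
  functions \<open>< \<infinity>\<close> are bounded above on a circle, so \<open>\<infinity> - \<infinity>\<close> does not occur below.\<close>

definition circle_mean :: "(complex^'n \<Rightarrow> ereal) \<Rightarrow> complex^'n \<Rightarrow> complex^'n \<Rightarrow> ereal" where
  "circle_mean u z w =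
     (enn2ereal (\<integral>\<^sup>+\<theta>\<in>{0..2*pi}. e2ennreal (u (z + cis \<theta> *s w)) \<partial>lborel) -
      enn2ereal (\<integral>\<^sup>+\<theta>\<in>{0..2*pi}. e2ennreal (- u (z + cis \<theta> *s w)) \<partial>lborel)) / ereal (2*pi)"

text \<open>Upper semicontinuous with values in \<open>[-\<infinity>, \<infinity>)\<close>, not identically \<open>-\<infinity>\<close> on any component, and
  satisfying the sub-mean value inequality on every closed disc in a complex line.\<close>

definition psh_on :: "(complex^'n) set \<Rightarrow> (complex^'n \<Rightarrow> ereal) \<Rightarrow> bool" where
  "psh_on U u \<longleftrightarrow>
     (\<forall>z\<in>U. u z < \<infinity>) \<and>
     (\<forall>z\<in>U. \<forall>c. u z < c \<longrightarrow> (\<forall>\<^sub>F y in at z. u y < c)) \<and>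
     (\<forall>C\<in>components U. \<exists>y\<in>C. u y \<noteq> -\<infinity>) \<and>
     (\<forall>z w. (\<forall>\<zeta>. cmod \<zeta> \<le> 1 \<longrightarrow> z + \<zeta> *s w \<in> U) \<longrightarrow> u z \<le> circle_mean u z w)"

definition lelong_number :: "(complex^'n \<Rightarrow> ereal) \<Rightarrow> complex^'n \<Rightarrow> ereal" where
  "lelong_number u a = Lim (at_right 0) (\<lambda>r::real. (SUP z\<in>ball a r. u z) / ereal (ln r))"

end

theory Submission
  imports Defs
begin

text \<open>The positive Lelong number at \<open>a\<close> gives \<open>u0 z \<le> \<nu> ln |z - a| + C\<close> near \<open>a\<close> with \<open>\<nu> > 0\<close>. For \<open>\<epsilon> > 0\<close>
  compare \<open>u\<close> on a small closed ball around \<open>a\<close> with the smooth function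
  \<open>\<psi> z t = (\<nu> - c t) / 2 ln (|z - a|\<^sup>2 + \<epsilon>) + C0 + C2 t\<close>, where \<open>c = 2 n + A \<nu>\<close> and \<open>n\<close> is the dimension.
  Its complex Hessian is at most \<open>\<nu> / (2 (|z - a|\<^sup>2 + \<epsilon>))\<close> times the identity, so the logarithm of the determinant
  of any smaller positive definite matrix is at most \<open>const - n ln (|z - a|\<^sup>2 + \<epsilon>)\<close>, and the choice of \<open>c\<close> makes
  \<open>\<psi>\<close> a strict supersolution, with all constants independent of \<open>\<epsilon>\<close>. The sub-mean value inequality turns the
  \<open>L\<^sup>1\<close> convergence into \<open>u \<le> \<psi>\<close> on the parabolic boundary. Hence \<open>u \<le> \<psi>\<close> at \<open>a\<close>
  and some time \<open>t > 0\<close> with \<open>t < \<nu> / c\<close>, while \<open>\<psi>\<close> tends to \<open>- \<infinity>\<close> there as \<open>\<epsilon> \<rightarrow> 0\<close>.\<close>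

section \<open>Sub-mean value inequalities\<close>

lemma circle_integral_ge_center:
  fixes g a b a1 a2 b1 b2 :: "complex \<Rightarrow> real"
  assumes S: "cball 0 1 \<subseteq> S"
    and g: "\<And>\<zeta>. \<zeta> \<in> S \<Longrightarrow> (g has_derivative (\<lambda>h. a \<zeta> * Re h + b \<zeta> * Im h)) (at \<zeta>)"
    and a: "\<And>\<zeta>. \<zeta> \<in> S \<Longrightarrow> (a has_derivative (\<lambda>h. a1 \<zeta> * Re h + a2 \<zeta> * Im h)) (at \<zeta>)"
    and b: "\<And>\<zeta>. \<zeta> \<in> S \<Longrightarrow> (b has_derivative (\<lambda>h. b1 \<zeta> * Re h + b2 \<zeta> * Im h)) (at \<zeta>)"
    and cont: "continuous_on S a1" "continuous_on S a2" "continuous_on S b1" "continuous_on S b2"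
    and pos: "\<And>\<zeta>. \<zeta> \<in> S \<Longrightarrow> 0 \<le> a1 \<zeta> + b2 \<zeta>"
  shows "2 * pi * g 0 \<le> integral {0..2*pi} (\<lambda>\<theta>. g (cis \<theta>))"
proof -
  define e where "e = (\<lambda>s \<theta>. complex_of_real s * cis \<theta>)"
  define J where "J = (\<lambda>s \<theta>. cos \<theta> * a (e s \<theta>) + sin \<theta> * b (e s \<theta>) +
     s * ((cos \<theta>)\<^sup>2 * a1 (e s \<theta>) + cos \<theta> * sin \<theta> * (a2 (e s \<theta>) + b1 (e s \<theta>)) + (sin \<theta>)\<^sup>2 * b2 (e s \<theta>)))"
  define N where "N = (\<lambda>s \<theta>. - sin \<theta> * a (e s \<theta>) + cos \<theta> * b (e s \<theta>))"
  define N' where "N' = (\<lambda>s \<theta>. - cos \<theta> * a (e s \<theta>) - sin \<theta> * b (e s \<theta>) +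
     s * ((sin \<theta>)\<^sup>2 * a1 (e s \<theta>) - cos \<theta> * sin \<theta> * (a2 (e s \<theta>) + b1 (e s \<theta>)) + (cos \<theta>)\<^sup>2 * b2 (e s \<theta>)))"
  define D where "D = (\<lambda>s \<theta>. cos \<theta> * a (e s \<theta>) + sin \<theta> * b (e s \<theta>))"
  define m where "m = (\<lambda>s. integral {0..2*pi} (\<lambda>\<theta>. g (e s \<theta>)))"
  define k where "k = (\<lambda>s. integral {0..2*pi} (\<lambda>\<theta>. s * D s \<theta>))"
  have eS: "e s \<theta> \<in> S" if "s \<in> {0..1}" for s \<theta>
    using that S by (auto simp: e_def norm_mult)
  have contg: "continuous_on S g" "continuous_on S a" "continuous_on S b"
    by (meson g a b has_derivative_continuous continuous_at_imp_continuous_on)+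
  have e_cont: "continuous_on X (\<lambda>x. e (p x) (q x))"
    if "continuous_on X p" "continuous_on X q" for X :: "'b::topological_space set" and p q
    unfolding e_def cis_conv_exp using that by (intro continuous_intros)
  have ce: "continuous_on X (\<lambda>x. h (e (p x) (q x)))"
    if "continuous_on S h" "continuous_on X p" "continuous_on X q" "\<And>x. x \<in> X \<Longrightarrow> p x \<in> {0..1}"
    for X :: "'b::topological_space set" and p q and h :: "complex \<Rightarrow> real"
    by (rule continuous_on_compose2[OF that(1) e_cont[OF that(2,3)]]) (use that eS in auto)
  note ci = contg[THEN ce] cont[THEN ce] continuous_intros
  have ds: "((\<lambda>s. h (e s \<theta>)) has_real_derivative h1 * cos \<theta> + h2 * sin \<theta>) (at s within U)"
    if "(h has_derivative (\<lambda>v. h1 * Re v + h2 * Im v)) (at (e s \<theta>))" for h h1 h2 s \<theta> U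
  proof -
    have "((\<lambda>s. e s \<theta>) has_derivative (\<lambda>v. complex_of_real v * cis \<theta>)) (at s within U)"
      unfolding e_def by (auto intro!: derivative_eq_intros)
    from has_derivative_compose[OF this that] show ?thesis
      unfolding has_field_derivative_def
      by (rule has_derivative_eq_rhs) (auto simp: algebra_simps)
  qed
  have dt: "((\<lambda>\<theta>. h (e s \<theta>)) has_real_derivative s * (- sin \<theta> * h1 + cos \<theta> * h2)) (at \<theta> within U)"
    if "(h has_derivative (\<lambda>v. h1 * Re v + h2 * Im v)) (at (e s \<theta>))" for h h1 h2 s \<theta> U
  proof -
    have "((\<lambda>\<theta>. e s \<theta>) has_derivative (\<lambda>v. complex_of_real v * (\<i> * complex_of_real s * cis \<theta>))) (at \<theta> within U)"
    proof -
      have "((\<lambda>\<theta>. complex_of_real (s * cos \<theta>) + \<i> * complex_of_real (s * sin \<theta>)) has_derivative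
          (\<lambda>v. complex_of_real v * (\<i> * complex_of_real s * cis \<theta>))) (at \<theta> within U)"
        by (rule derivative_eq_intros refl)+ (auto simp: complex_eq_iff)
      moreover have "e s \<theta> = complex_of_real (s * cos \<theta>) + \<i> * complex_of_real (s * sin \<theta>)" for \<theta>
        by (simp add: e_def complex_eq_iff)
      ultimately show ?thesis by simp
    qed
    from has_derivative_compose[OF this that] show ?thesis
      unfolding has_field_derivative_def
      by (rule has_derivative_eq_rhs) (auto simp: algebra_simps)
  qed
  have k_deriv: "(k has_real_derivative integral {0..2*pi} (J s)) (at s within {0..1})" if s: "s \<in> {0..1}" for s
    unfolding k_def box_real(2)[of 0 "2*pi", symmetric]
  proof (rule leibniz_rule_field_derivative[OF _ _ _ s])
    fix x t :: real assume x: "x \<in> {0..1}"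
    show "((\<lambda>x. x * D x t) has_real_derivative J x t) (at x within {0..1})"
      unfolding J_def D_def
      by (rule derivative_eq_intros ds[OF a] ds[OF b] eS x refl)+ (simp add: algebra_simps power2_eq_square)
    show "(\<lambda>\<theta>. x * D x \<theta>) integrable_on cbox 0 (2*pi)"
      unfolding D_def by (intro integrable_continuous ci) (use x in auto)
  next
    show "continuous_on ({0..1} \<times> cbox 0 (2 * pi)) (\<lambda>(x, t). J x t)"
      unfolding J_def case_prod_beta by (intro ci) auto
  qed auto
  have J_nonneg: "0 \<le> integral {0..2*pi} (J s)" if s: "s \<in> {0..1}" for s
  proof -
    have "(N' s has_integral (N s (2*pi) - N s 0)) {0..2*pi}"
    proof (rule fundamental_theorem_of_calculus)
      fix x show "(N s has_vector_derivative N' s x) (at x within {0..2*pi})"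
        unfolding N_def N'_def has_real_derivative_iff_has_vector_derivative[symmetric]
        by (rule derivative_eq_intros dt[OF a] dt[OF b] eS s refl)+ (simp add: algebra_simps power2_eq_square)
    qed simp
    moreover have "N s (2*pi) - N s 0 = 0" by (simp add: N_def e_def)
    ultimately have N': "(N' s has_integral 0) {0..2*pi}" by simp
    have "J s integrable_on {0..2*pi}"
      unfolding J_def by (intro integrable_continuous_real ci) (use s in auto)
    then have "((\<lambda>\<theta>. J s \<theta> + N' s \<theta>) has_integral integral {0..2*pi} (J s) + 0) {0..2*pi}"
      by (intro has_integral_add N') (simp add: integrable_integral)
    moreover have "J s \<theta> + N' s \<theta> = s * (a1 (e s \<theta>) + b2 (e s \<theta>)) * ((sin \<theta>)\<^sup>2 + (cos \<theta>)\<^sup>2)" for \<theta>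
      unfolding J_def N'_def by algebra
    ultimately have "((\<lambda>\<theta>. s * (a1 (e s \<theta>) + b2 (e s \<theta>))) has_integral integral {0..2*pi} (J s)) {0..2*pi}"
      by simp
    then show ?thesis
      by (rule has_integral_nonneg) (use s pos[OF eS[OF s]] in simp)
  qed
  have mono01: "h 0 \<le> h s" if s: "s \<in> {0..1}"
    and h: "\<And>x. x \<in> {0..1} \<Longrightarrow> (h has_real_derivative h' x) (at x within {0..1})"
    and pos: "\<And>x. x \<in> {0<..1} \<Longrightarrow> 0 \<le> h' x" for h h' :: "real \<Rightarrow> real" and s
  proof -
    have "continuous_on {0..s} h"
      using s by (intro DERIV_continuous_on[of _ _ h'] DERIV_subset[OF h]) auto
    moreover have "(h has_real_derivative h' x) (at x)" if "0 < x" "x < s" for x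
      using h[of x] that s at_within_interior[of x "{0..1}"] by simp
    ultimately show ?thesis
    proof (intro DERIV_nonneg_imp_increasing_open[of 0 s h])
      fix x assume "0 < x" "x < s"
      with \<open>\<And>x. 0 < x \<Longrightarrow> x < s \<Longrightarrow> (h has_real_derivative h' x) (at x)\<close> pos[of x] s
      show "\<exists>y. DERIV h x :> y \<and> 0 \<le> y" by auto
    qed (use s in auto)
  qed
  have k_nonneg: "0 \<le> k s" if s: "s \<in> {0..1}" for s
    using mono01[OF s k_deriv J_nonneg] by (simp add: k_def)
  have m_deriv: "(m has_real_derivative integral {0..2*pi} (D s)) (at s within {0..1})" if s: "s \<in> {0..1}" for s
    unfolding m_def box_real(2)[of 0 "2*pi", symmetric]
  proof (rule leibniz_rule_field_derivative[OF _ _ _ s])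
    fix x t :: real assume x: "x \<in> {0..1}"
    show "((\<lambda>x. g (e x t)) has_real_derivative D x t) (at x within {0..1})"
      unfolding D_def
      by (rule DERIV_cong[OF ds[OF g[OF eS[OF x]]]]) (simp add: algebra_simps)
    show "(\<lambda>\<theta>. g (e x \<theta>)) integrable_on cbox 0 (2*pi)"
      by (intro integrable_continuous ci) (use x in auto)
  next
    show "continuous_on ({0..1} \<times> cbox 0 (2 * pi)) (\<lambda>(x, t). D x t)"
      unfolding D_def case_prod_beta by (intro ci) auto
  qed auto
  have "0 \<le> integral {0..2*pi} (D s)" if "s \<in> {0<..1}" for s
    using k_nonneg[of s] that by (simp add: k_def zero_le_mult_iff)
  from mono01[OF _ m_deriv this, of 1] have "m 0 \<le> m 1" by simp
  then show ?thesis by (simp add: m_def e_def)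
qed

lemma nn_integral_lborel_translate:
  fixes f :: "'a::euclidean_space \<Rightarrow> ennreal"
  assumes [measurable]: "f \<in> borel_measurable borel"
  shows "(\<integral>\<^sup>+x. f (c + x) \<partial>lborel) = (\<integral>\<^sup>+x. f x \<partial>lborel)"
proof -
  have "(\<integral>\<^sup>+x. f x \<partial>lborel) = (\<integral>\<^sup>+x. f x \<partial>distr lborel borel ((+) c))"
    by (simp add: lborel_distr_plus)
  then show ?thesis by (simp add: nn_integral_distr)
qed

lemma nn_integral_lborel_reflect:
  fixes f :: "'a::euclidean_space \<Rightarrow> ennreal"
  assumes [measurable]: "f \<in> borel_measurable borel"
  shows "(\<integral>\<^sup>+x. f (c - x) \<partial>lborel) = (\<integral>\<^sup>+x. f x \<partial>lborel)"
proof -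
  have "(\<integral>\<^sup>+x. f x \<partial>lborel) = (\<integral>\<^sup>+x. f x \<partial>distr lborel borel (\<lambda>x. c - x))"
    by (subst lborel_affine[of "-1" c]) (auto simp: density_1)
  then show ?thesis by (simp add: nn_integral_distr)
qed

text \<open>Fubini turns \<open>(\<integral> f \<circ> R) (\<integral> g)\<close> into \<open>(\<integral> f) (\<integral> g \<circ> R)\<close>, as for the uniqueness of Haar measure;
  take for \<open>g\<close> the indicator function of the unit ball, which is invariant under \<open>R\<close>.\<close>

lemma nn_integral_lborel_linear_isometry:
  fixes f :: "'a::euclidean_space \<Rightarrow> ennreal" and R R' :: "'a \<Rightarrow> 'a"
  assumes lin: "linear R" and iso: "\<And>x. norm (R x) = norm x" and inv: "\<And>x. R (R' x) = x"
    and f[measurable]: "f \<in> borel_measurable borel"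
  shows "(\<integral>\<^sup>+x. f (R x) \<partial>lborel) = (\<integral>\<^sup>+x. f x \<partial>lborel)"
proof -
  have [measurable]: "R \<in> borel_measurable borel"
    using lin by (intro borel_measurable_continuous_onI linear_continuous_on) (simp add: linear_linear)
  define g :: "'a \<Rightarrow> ennreal" where "g = indicator (ball 0 1)"
  have [measurable]: "g \<in> borel_measurable borel" unfolding g_def by (rule borel_measurable_indicator) simp
  have gR: "g (R x) = g x" for x :: 'a by (simp add: g_def indicator_def iso)
  have V: "(\<integral>\<^sup>+x. g x \<partial>lborel) = emeasure lborel (ball (0::'a) 1)" by (simp add: g_def)
  have "(\<integral>\<^sup>+x. f (R x) \<partial>lborel) * (\<integral>\<^sup>+y. g y \<partial>lborel) = (\<integral>\<^sup>+x. \<integral>\<^sup>+y. f (R x) * g y \<partial>lborel \<partial>lborel)"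
    by (simp add: nn_integral_cmult nn_integral_multc)
  also have "\<dots> = (\<integral>\<^sup>+x. \<integral>\<^sup>+y. f (R x) * g (R x + y) \<partial>lborel \<partial>lborel)"
    by (simp add: nn_integral_cmult nn_integral_lborel_translate)
  also have "\<dots> = (\<integral>\<^sup>+y. \<integral>\<^sup>+x. f (R x) * g (R x + y) \<partial>lborel \<partial>lborel)"
    by (rule lborel_pair.Fubini') measurable
  also have "\<dots> = (\<integral>\<^sup>+y. \<integral>\<^sup>+x. f (R x - y) * g (R x) \<partial>lborel \<partial>lborel)"
  proof (rule nn_integral_cong)
    fix y
    have "R (- R' y + x) = R x - y" for x
      using lin inv[of y] by (simp add: linear_diff)
    then show "(\<integral>\<^sup>+x. f (R x) * g (R x + y) \<partial>lborel) = (\<integral>\<^sup>+x. f (R x - y) * g (R x) \<partial>lborel)"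
      by (subst nn_integral_lborel_translate[of "\<lambda>x. f (R x) * g (R x + y)" "- R' y", symmetric]) auto
  qed
  also have "\<dots> = (\<integral>\<^sup>+x. \<integral>\<^sup>+y. f (R x - y) * g (R x) \<partial>lborel \<partial>lborel)"
    by (rule lborel_pair.Fubini') measurable
  also have "\<dots> = (\<integral>\<^sup>+x. f x \<partial>lborel) * (\<integral>\<^sup>+y. g y \<partial>lborel)"
    by (simp add: nn_integral_cmult nn_integral_multc nn_integral_lborel_reflect gR)
  finally have *: "(\<integral>\<^sup>+x. f (R x) \<partial>lborel) * emeasure lborel (ball (0::'a) 1) =
    (\<integral>\<^sup>+x. f x \<partial>lborel) * emeasure lborel (ball (0::'a) 1)" by (simp add: V)
  have "emeasure lborel (ball (0::'a) 1) \<noteq> 0"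
    using content_ball_pos[of 1 "0::'a"] by (auto simp: measure_def)
  moreover have "emeasure lborel (ball (0::'a) 1) \<noteq> \<infinity>"
    using emeasure_lborel_ball_finite[of "0::'a" 1] by simp
  ultimately show ?thesis
    using * by (auto simp: mult.commute[of _ "emeasure _ _"] ennreal_mult_cancel_left)
qed

lemma norm_vector_scalar_mult: "norm (c *s w) = cmod c * norm w" for w :: "complex^'n"
  by (simp add: norm_vec_def L2_set_right_distrib norm_mult)

lemma linear_vector_scalar_mult: "linear (\<lambda>w. c *s (w :: complex^'n))"
  by (intro linearI) (simp_all add: vec_eq_iff algebra_simps)

lemma continuous_on_vector_scalar_mult [continuous_intros]:
  fixes f :: "'a::topological_space \<Rightarrow> complex" and g :: "'a \<Rightarrow> complex^'n"
  assumes "continuous_on S f" "continuous_on S g"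
  shows "continuous_on S (\<lambda>x. f x *s g x)"
  unfolding vector_scalar_mult_def using assms by (intro continuous_intros)

lemma nn_integral_continuous_on:
  fixes h :: "real \<Rightarrow> real"
  assumes "continuous_on {a..b} h"
  shows "(\<integral>\<^sup>+x\<in>{a..b}. ennreal (h x) \<partial>lborel) = ennreal (integral {a..b} (\<lambda>x. max 0 (h x)))"
proof -
  have c: "continuous_on {a..b} (\<lambda>x. max 0 (h x))" using assms by (intro continuous_intros)
  have "(\<integral>\<^sup>+x\<in>{a..b}. ennreal (h x) \<partial>lborel) = (\<integral>\<^sup>+x. ennreal (indicator {a..b} x *\<^sub>R max 0 (h x)) \<partial>lborel)"
    by (intro nn_integral_cong) (auto simp: indicator_def max_def ennreal_neg)
  also have "\<dots> = ennreal (LINT x:{a..b}|lborel. max 0 (h x))"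
    unfolding set_lebesgue_integral_def
    using borel_integrable_atLeastAtMost'[OF c]
    by (intro nn_integral_eq_integral) (auto simp: set_integrable_def)
  also have "(LINT x:{a..b}|lborel. max 0 (h x)) = integral {a..b} (\<lambda>x. max 0 (h x))"
    using borel_integrable_atLeastAtMost'[OF c] by (simp add: set_borel_integral_eq_integral)
  finally show ?thesis .
qed

lemma integral_le_nn_integral:
  fixes h :: "real \<Rightarrow> real"
  assumes "continuous_on {a..b} h"
  shows "ennreal (integral {a..b} h) \<le> (\<integral>\<^sup>+x\<in>{a..b}. ennreal (h x) \<partial>lborel)"
  unfolding nn_integral_continuous_on[OF assms]
  using assms by (intro ennreal_leI integral_le integrable_continuous_real continuous_intros) auto

lemma submean_ball:
  fixes g :: "complex^'n \<Rightarrow> real"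
  assumes circle: "\<And>w. w \<in> ball 0 r \<Longrightarrow> 2 * pi * g z \<le> integral {0..2*pi} (\<lambda>\<theta>. g (z + cis \<theta> *s w))"
    and g: "continuous_on (ball z r) g"
  shows "ennreal (g z) * emeasure lborel (ball z r) \<le> (\<integral>\<^sup>+y\<in>ball z r. ennreal (g y) \<partial>lborel)"
proof -
  define P where "P = (\<lambda>w. ennreal (g (z + w)) * indicator (ball 0 r) w)"
  have "(\<lambda>w. indicator (ball 0 r) w *\<^sub>R g (z + w)) \<in> borel_measurable borel"
    by (intro borel_measurable_continuous_on_indicator continuous_on_compose2[OF g])
      (auto intro!: continuous_intros simp: dist_norm)
  then have "(\<lambda>w. ennreal (indicator (ball 0 r) w *\<^sub>R g (z + w))) \<in> borel_measurable borel"
    by measurable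
  also have "(\<lambda>w. ennreal (indicator (ball 0 r) w *\<^sub>R g (z + w))) = P"
    by (auto simp: P_def indicator_def)
  finally have P[measurable]: "P \<in> borel_measurable borel" .
  have [measurable]: "(\<lambda>(w, \<theta>). cis \<theta> *s w) \<in> borel_measurable (borel \<Otimes>\<^sub>M borel :: ((complex^'n) \<times> real) measure)"
    unfolding borel_prod case_prod_beta cis_conv_exp by (intro borel_measurable_continuous_onI continuous_intros)
  have PR[measurable]: "(\<lambda>(w, \<theta>). P (cis \<theta> *s w) * indicator {0..2*pi} \<theta>) \<in> borel_measurable (borel \<Otimes>\<^sub>M borel)"
    by measurable
  have "ennreal (2 * pi * g z) * emeasure lborel (ball (0::complex^'n) r) =
      (\<integral>\<^sup>+w. ennreal (2 * pi * g z) * indicator (ball (0::complex^'n) r) w \<partial>lborel)"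
    by (simp add: nn_integral_cmult_indicator)
  also have "\<dots> \<le> (\<integral>\<^sup>+w. \<integral>\<^sup>+\<theta>. P (cis \<theta> *s w) * indicator {0..2*pi} \<theta> \<partial>lborel \<partial>lborel)"
  proof (rule nn_integral_mono)
    fix w :: "complex^'n"
    show "ennreal (2 * pi * g z) * indicator (ball 0 r) w
        \<le> (\<integral>\<^sup>+\<theta>. P (cis \<theta> *s w) * indicator {0..2*pi} \<theta> \<partial>lborel)"
    proof (cases "w \<in> ball 0 r")
      case True
      have "ennreal (2 * pi * g z) \<le> ennreal (integral {0..2*pi} (\<lambda>\<theta>. g (z + cis \<theta> *s w)))"
        by (rule ennreal_leI) (rule circle[OF True])
      also have "\<dots> \<le> (\<integral>\<^sup>+\<theta>\<in>{0..2*pi}. ennreal (g (z + cis \<theta> *s w)) \<partial>lborel)"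
        using True by (intro integral_le_nn_integral continuous_on_compose2[OF g])
          (auto intro!: continuous_intros simp: dist_norm norm_vector_scalar_mult cis_conv_exp)
      also have "\<dots> = (\<integral>\<^sup>+\<theta>. P (cis \<theta> *s w) * indicator {0..2*pi} \<theta> \<partial>lborel)"
        using True by (simp add: P_def norm_vector_scalar_mult)
      finally show ?thesis using True by simp
    qed simp
  qed
  also have "\<dots> = (\<integral>\<^sup>+\<theta>. \<integral>\<^sup>+w. P (cis \<theta> *s w) * indicator {0..2*pi} \<theta> \<partial>lborel \<partial>lborel)"
    using PR by (intro lborel_pair.Fubini') (simp add: measurable_cong_sets[OF sets_pair_measure_cong[OF sets_lborel sets_lborel] refl])
  also have "\<dots> = (\<integral>\<^sup>+\<theta>. (\<integral>\<^sup>+w. P w \<partial>lborel) * indicator {0..2*pi} \<theta> \<partial>lborel)"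
  proof (rule nn_integral_cong)
    fix \<theta> :: real
    have [measurable]: "(\<lambda>w::complex^'n. cis \<theta> *s w) \<in> borel_measurable borel"
      by (intro borel_measurable_continuous_onI continuous_intros)
    have "(\<integral>\<^sup>+w. P (cis \<theta> *s w) \<partial>lborel) = (\<integral>\<^sup>+w. P w \<partial>lborel)"
      by (rule nn_integral_lborel_linear_isometry[where R' = "\<lambda>w. cis (-\<theta>) *s w"])
        (auto simp: linear_vector_scalar_mult norm_vector_scalar_mult vector_smult_assoc cis_mult)
    then show "(\<integral>\<^sup>+w. P (cis \<theta> *s w) * indicator {0..2*pi} \<theta> \<partial>lborel) =
        (\<integral>\<^sup>+w. P w \<partial>lborel) * indicator {0..2*pi} \<theta>"
      by (simp add: nn_integral_multc)
  qed
  also have "\<dots> = (\<integral>\<^sup>+w. P w \<partial>lborel) * ennreal (2*pi)"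
    by (simp add: nn_integral_cmult_indicator)
  also have "(\<integral>\<^sup>+w. P w \<partial>lborel) = (\<integral>\<^sup>+y. P (- z + y) \<partial>lborel)"
    by (rule nn_integral_lborel_translate[OF P, symmetric])
  also have "\<dots> = (\<integral>\<^sup>+y\<in>ball z r. ennreal (g y) \<partial>lborel)"
    by (intro nn_integral_cong) (auto simp: P_def indicator_def dist_norm norm_minus_commute)
  finally have "ennreal (2 * pi * g z) * emeasure lborel (ball (0::complex^'n) r) \<le>
    (\<integral>\<^sup>+y\<in>ball z r. ennreal (g y) \<partial>lborel) * ennreal (2 * pi)" .
  moreover have "ennreal (2 * pi * g z) = ennreal (2 * pi) * ennreal (g z)"
    by (rule ennreal_mult') simp
  ultimately have "ennreal (2*pi) * (ennreal (g z) * emeasure lborel (ball (0::complex^'n) r))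
      \<le> ennreal (2*pi) * (\<integral>\<^sup>+y\<in>ball z r. ennreal (g y) \<partial>lborel)"
    by (simp only: mult_ac)
  moreover have "emeasure lborel (ball z r) = emeasure lborel (ball (0::complex^'n) r)"
    by (cases "0 \<le> r") (simp_all add: emeasure_ball ball_empty)
  ultimately show ?thesis
    by (subst (asm) ennreal_mult_le_mult_iff) auto
qed

section \<open>The complex Hessian\<close>

abbreviation second_derivative :: "('a::real_normed_vector \<Rightarrow> real) \<Rightarrow> 'a \<Rightarrow> 'a \<Rightarrow> 'a \<Rightarrow> real" where
  "second_derivative g z v v' \<equiv> frechet_derivative (\<lambda>x. frechet_derivative g (at x) v) (at z) v'"

lemma smooth_onD:
  assumes "smooth_on W g"
  shows "x \<in> W \<Longrightarrow> (g has_derivative frechet_derivative g (at x)) (at x)"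
    and "x \<in> W \<Longrightarrow> ((\<lambda>x. frechet_derivative g (at x) v) has_derivative second_derivative g x v) (at x)"
    and "continuous_on W (\<lambda>x. second_derivative g x v v')"
    and "continuous_on W g"
proof -
  have "Ck_on (Suc (Suc 0)) W g" "Ck_on 0 W g"
    using assms unfolding smooth_on_def by blast+
  then show "x \<in> W \<Longrightarrow> (g has_derivative frechet_derivative g (at x)) (at x)"
    and "x \<in> W \<Longrightarrow> ((\<lambda>x. frechet_derivative g (at x) v) has_derivative second_derivative g x v) (at x)"
    and "continuous_on W (\<lambda>x. second_derivative g x v v')"
    and "continuous_on W g"
    by (auto simp: frechet_derivative_works[symmetric])
qed

lemma bilinear_second_derivative:
  assumes W: "open W" "z \<in> W" and g: "smooth_on W g"
  shows "bilinear (second_derivative g z)"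
proof -
  note D = smooth_onD[OF g]
  have lin: "linear (frechet_derivative g (at x))" if "x \<in> W" for x
    using D(1)[OF that] has_derivative_linear by blast
  have "linear (second_derivative g z v)" for v
    using D(2)[OF W(2)] has_derivative_linear by blast
  moreover have "linear (\<lambda>v. second_derivative g z v v')" for v'
  proof (rule linearI)
    fix v1 v2 and c :: real
    have "((\<lambda>x. frechet_derivative g (at x) (v1 + v2)) has_derivative
        (\<lambda>v'. second_derivative g z v1 v' + second_derivative g z v2 v')) (at z)"
      by (rule has_derivative_transform_within_open[OF has_derivative_add[OF D(2)[OF W(2)] D(2)[OF W(2)]] W])
        (simp add: linear_add[OF lin])
    from frechet_derivative_at[OF this] show "second_derivative g z (v1 + v2) v' = second_derivative g z v1 v' + second_derivative g z v2 v'"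
      by (simp add: fun_eq_iff)
    have "((\<lambda>x. frechet_derivative g (at x) (c *\<^sub>R v1)) has_derivative
        (\<lambda>v'. c *\<^sub>R second_derivative g z v1 v')) (at z)"
      by (rule has_derivative_transform_within_open[OF has_derivative_scaleR_right[OF D(2)[OF W(2)]] W])
        (simp add: linear_cmul[OF lin])
    from frechet_derivative_at[OF this] show "second_derivative g z (c *\<^sub>R v1) v' = c *\<^sub>R second_derivative g z v1 v'"
      by (simp add: fun_eq_iff)
  qed
  ultimately show ?thesis by (simp add: bilinear_def)
qed

lemma complex_hessian_nth:
  assumes W: "open W" "z \<in> W" and g: "smooth_on W g"
  shows "complex_hessian g z $ \<alpha> $ \<beta> = Complex
    ((second_derivative g z (axis \<beta> 1) (axis \<alpha> 1) + second_derivative g z (axis \<beta> \<i>) (axis \<alpha> \<i>)) / 4)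
    ((second_derivative g z (axis \<beta> \<i>) (axis \<alpha> 1) - second_derivative g z (axis \<beta> 1) (axis \<alpha> \<i>)) / 4)"
proof -
  note D = smooth_onD[OF g]
  let ?h = "\<lambda>x. (complex_of_real (frechet_derivative g (at x) (axis \<beta> 1)) +
          \<i> * complex_of_real (frechet_derivative g (at x) (axis \<beta> \<i>))) / 2"
  have "d_zbar \<beta> (\<lambda>w. complex_of_real (g w)) x = ?h x" if "x \<in> W" for x
    using frechet_derivative_at[OF has_derivative_of_real[OF D(1)[OF that], where 'a=complex], symmetric]
    by (simp add: d_zbar_def)
  moreover have "(?h has_derivative (\<lambda>v'. (complex_of_real (second_derivative g z (axis \<beta> 1) v') +
          \<i> * complex_of_real (second_derivative g z (axis \<beta> \<i>) v')) / 2)) (at z)"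
    by (rule bounded_linear.has_derivative[OF bounded_linear_divide has_derivative_add[OF
        has_derivative_of_real[OF D(2)[OF W(2)]] has_derivative_mult_right[OF has_derivative_of_real[OF D(2)[OF W(2)]]]]])
  ultimately have "(d_zbar \<beta> (\<lambda>w. complex_of_real (g w)) has_derivative
     (\<lambda>v'. (complex_of_real (second_derivative g z (axis \<beta> 1) v') +
          \<i> * complex_of_real (second_derivative g z (axis \<beta> \<i>) v')) / 2)) (at z)"
    using has_derivative_transform_within_open[where f = ?h, OF _ W] by presburger
  then have F: "frechet_derivative (d_zbar \<beta> (\<lambda>w. complex_of_real (g w))) (at z) =
     (\<lambda>v'. (complex_of_real (second_derivative g z (axis \<beta> 1) v') +
          \<i> * complex_of_real (second_derivative g z (axis \<beta> \<i>) v')) / 2)"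
    by (rule frechet_derivative_at[symmetric])
  show ?thesis
    by (simp add: complex_hessian_def d_z_def F complex_eq_iff)
qed

lemma vec_complex_decomposition:
  "(w :: complex^'n) = (\<Sum>\<alpha>\<in>UNIV. Re (w $ \<alpha>) *\<^sub>R axis \<alpha> 1 + Im (w $ \<alpha>) *\<^sub>R axis \<alpha> \<i>)"
proof -
  have "(\<Sum>\<alpha>\<in>UNIV. Re (w $ \<alpha>) *\<^sub>R axis \<alpha> 1 + Im (w $ \<alpha>) *\<^sub>R axis \<alpha> \<i>) $ \<beta> = w $ \<beta>" for \<beta>
  proof -
    have "(\<Sum>\<alpha>\<in>UNIV. Re (w $ \<alpha>) *\<^sub>R axis \<alpha> 1 + Im (w $ \<alpha>) *\<^sub>R axis \<alpha> \<i>) $ \<beta>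
        = (\<Sum>\<alpha>\<in>UNIV. if \<alpha> = \<beta> then w $ \<beta> else 0)"
      unfolding sum_component by (intro sum.cong) (auto simp: axis_def complex_eq_iff)
    then show ?thesis by simp
  qed
  then show ?thesis by (simp add: vec_eq_iff)
qed

lemma bilinear_levi_form:
  fixes B :: "complex^'n \<Rightarrow> complex^'n \<Rightarrow> real"
  assumes B: "bilinear B"
  shows "B w w + B (\<i> *s w) (\<i> *s w) =
    Re (\<Sum>\<alpha>\<in>UNIV. \<Sum>\<beta>\<in>UNIV. Complex (B (axis \<beta> 1) (axis \<alpha> 1) + B (axis \<beta> \<i>) (axis \<alpha> \<i>))
       (B (axis \<beta> \<i>) (axis \<alpha> 1) - B (axis \<beta> 1) (axis \<alpha> \<i>)) * w $ \<alpha> * cnj (w $ \<beta>))"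
proof -
  have l: "linear (\<lambda>x. B x y)" "linear (B x)" for x y
    using B by (auto simp: bilinear_def)
  define E where "E = (\<lambda>(w::complex^'n) \<alpha>. Re (w $ \<alpha>) *\<^sub>R (axis \<alpha> 1 :: complex^'n) + Im (w $ \<alpha>) *\<^sub>R axis \<alpha> \<i>)"
  have exp: "B v v = (\<Sum>\<alpha>\<in>UNIV. \<Sum>\<beta>\<in>UNIV. B (E v \<beta>) (E v \<alpha>))" for v
  proof -
    have "B v v = B (\<Sum>\<beta>\<in>UNIV. E v \<beta>) (\<Sum>\<alpha>\<in>UNIV. E v \<alpha>)"
      unfolding E_def using vec_complex_decomposition[of v] by simp
    then show ?thesis by (simp add: linear_sum[OF l(1)] linear_sum[OF l(2)])
  qed
  have E: "B (E v \<beta>) (E v \<alpha>) = Re (v $ \<beta>) * Re (v $ \<alpha>) * B (axis \<beta> 1) (axis \<alpha> 1)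
      + Re (v $ \<beta>) * Im (v $ \<alpha>) * B (axis \<beta> 1) (axis \<alpha> \<i>)
      + Im (v $ \<beta>) * Re (v $ \<alpha>) * B (axis \<beta> \<i>) (axis \<alpha> 1)
      + Im (v $ \<beta>) * Im (v $ \<alpha>) * B (axis \<beta> \<i>) (axis \<alpha> \<i>)" for v \<alpha> \<beta>
    unfolding E_def
    by (simp add: linear_add[OF l(1)] linear_add[OF l(2)] linear_cmul[OF l(1)] linear_cmul[OF l(2)] distrib_left mult.assoc)
  show ?thesis
    unfolding exp sum.distrib[symmetric] Re_sum E
    by (intro sum.cong refl) (simp add: algebra_simps)
qed

definition levi_form :: "complex^'n^'n \<Rightarrow> complex^'n \<Rightarrow> complex" where
  "levi_form H w = (\<Sum>\<alpha>\<in>UNIV. \<Sum>\<beta>\<in>UNIV. H $ \<alpha> $ \<beta> * w $ \<alpha> * cnj (w $ \<beta>))"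

lemma Re_levi_form_complex_hessian:
  assumes "open W" "z \<in> W" "smooth_on W g"
  shows "Re (levi_form (complex_hessian g z) w) =
    (second_derivative g z w w + second_derivative g z (\<i> *s w) (\<i> *s w)) / 4"
proof -
  show ?thesis
    unfolding levi_form_def bilinear_levi_form[OF bilinear_second_derivative[OF assms]] complex_hessian_nth[OF assms]
      Re_sum sum_divide_distrib
    by (intro sum.cong refl) (simp add: field_simps)
qed

lemma levi_form_polarization:
  "4 * (\<Sum>\<alpha>\<in>UNIV. \<Sum>\<beta>\<in>UNIV. H $ \<alpha> $ \<beta> * v $ \<alpha> * cnj (w $ \<beta>)) =
    levi_form H (v + w) - levi_form H (v - w) + \<i> * levi_form H (v + \<i> *s w) - \<i> * levi_form H (v - \<i> *s w)"
  unfolding levi_form_def sum_distrib_left sum.distrib[symmetric] sum_subtractf[symmetric]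
  by (intro sum.cong refl) (simp add: algebra_simps)

lemma det_norm_le:
  fixes M :: "complex^'n^'n"
  assumes "\<And>i j. cmod (M $ i $ j) \<le> c"
  shows "cmod (det M) \<le> fact CARD('n) * c ^ CARD('n)"
proof -
  let ?P = "{p. p permutes (UNIV :: 'n set)}"
  have "cmod (det M) \<le> (\<Sum>p\<in>?P. cmod (of_int (sign p) * (\<Prod>i\<in>UNIV. M $ i $ p i)))"
    unfolding det_def by (rule norm_sum)
  also have "\<dots> \<le> (\<Sum>p\<in>?P. c ^ CARD('n))"
  proof (rule sum_mono)
    fix p
    have "cmod (of_int (sign p) * (\<Prod>i\<in>UNIV. M $ i $ p i)) = (\<Prod>i\<in>UNIV. cmod (M $ i $ p i))"
      by (simp add: norm_mult prod_norm sign_def)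
    also have "\<dots> \<le> (\<Prod>i\<in>(UNIV :: 'n set). c)"
      using assms by (intro prod_mono) auto
    finally show "cmod (of_int (sign p) * (\<Prod>i\<in>UNIV. M $ i $ p i)) \<le> c ^ CARD('n)" by simp
  qed
  also have "\<dots> = fact CARD('n) * c ^ CARD('n)"
    by (simp add: card_permutations[OF refl])
  finally show ?thesis .
qed

lemma norm_axis: "norm (axis i x) = norm x" for x :: "'a::real_inner"
  by (simp add: norm_eq_sqrt_inner inner_axis)

lemma positive_definite_det_le:
  fixes H :: "complex^'n^'n"
  assumes H: "positive_definite H" and le: "\<And>w. Re (levi_form H w) \<le> l * (norm w)\<^sup>2"
  shows "cmod (det H) \<le> fact CARD('n) * (4 * l) ^ CARD('n)"
proof (rule det_norm_le)
  fix \<alpha> \<beta>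
  have bound: "cmod (levi_form H w) \<le> 4 * l" if "norm w \<le> 2" for w
  proof (cases "w = 0")
    case True
    have "0 \<le> Re (levi_form H (axis \<alpha> 1))"
      using H by (simp add: positive_definite_def levi_form_def less_imp_le)
    with le[of "axis \<alpha> 1"] True show ?thesis by (simp add: levi_form_def norm_axis)
  next
    case False
    then have 1: "levi_form H w \<in> \<real>" "0 < Re (levi_form H w)"
      using H by (simp_all add: positive_definite_def levi_form_def)
    then have "0 < l * (norm w)\<^sup>2" using le[of w] by linarith
    then have "0 < l" by (simp add: zero_less_mult_iff)
    have "cmod (levi_form H w) = Re (levi_form H w)"
      using 1 by (metis Reals_cases Re_complex_of_real abs_of_pos norm_of_real)
    also have "\<dots> \<le> l * 2\<^sup>2"
      using le[of w] that \<open>0 < l\<close> by (meson mult_left_mono order_trans less_imp_le power_mono norm_ge_zero)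
    finally show ?thesis by simp
  qed
  have n: "norm (axis \<alpha> 1 + c *s axis \<beta> 1 :: complex^'n) \<le> 2" if "cmod c = 1" for c
  proof -
    have "c *s axis \<beta> 1 = axis \<beta> c" by (simp add: vec_eq_iff axis_def)
    then show ?thesis
      using norm_triangle_ineq[of "axis \<alpha> 1 :: complex^'n" "c *s axis \<beta> 1"] that by (simp add: norm_axis)
  qed
  define L where "L = (\<lambda>c. levi_form H (axis \<alpha> 1 + c *s axis \<beta> 1))"
  have L: "cmod (L c) \<le> 4 * l" if "cmod c = 1" for c
    unfolding L_def by (rule bound[OF n[OF that]])
  have "(\<Sum>\<alpha>'\<in>UNIV. \<Sum>\<beta>'\<in>UNIV. H $ \<alpha>' $ \<beta>' * axis \<alpha> 1 $ \<alpha>' * cnj (axis \<beta> 1 $ \<beta>')) =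
     (\<Sum>\<alpha>'\<in>UNIV. \<Sum>\<beta>'\<in>UNIV. if \<beta>' = \<beta> then if \<alpha>' = \<alpha> then H $ \<alpha> $ \<beta> else 0 else 0)"
    by (intro sum.cong refl) (auto simp: axis_def)
  then have "(\<Sum>\<alpha>'\<in>UNIV. \<Sum>\<beta>'\<in>UNIV. H $ \<alpha>' $ \<beta>' * axis \<alpha> 1 $ \<alpha>' * cnj (axis \<beta> 1 $ \<beta>')) = H $ \<alpha> $ \<beta>"
    by simp
  with levi_form_polarization[of H "axis \<alpha> 1" "axis \<beta> 1"]
  have "4 * H $ \<alpha> $ \<beta> = L 1 - L (-1) + \<i> * L \<i> - \<i> * L (-\<i>)"
    by (simp add: L_def)
  then have "4 * cmod (H $ \<alpha> $ \<beta>) = cmod (L 1 - L (-1) + \<i> * L \<i> - \<i> * L (-\<i>))"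
    by (metis norm_mult norm_numeral)
  also have "\<dots> \<le> cmod (L 1) + cmod (L (-1)) + cmod (L \<i>) + cmod (L (-\<i>))"
    using norm_triangle_ineq4[of "L 1 - L (-1) + \<i> * L \<i>" "\<i> * L (-\<i>)"]
      norm_triangle_ineq[of "L 1 - L (-1)" "\<i> * L \<i>"] norm_triangle_ineq4[of "L 1" "L (-1)"]
    by (simp add: norm_mult)
  also have "\<dots> \<le> 4 * (4 * l)"
    using L[of 1] L[of "-1"] L[of \<i>] L[of "-\<i>"] by simp
  finally show "cmod (H $ \<alpha> $ \<beta>) \<le> 4 * l" by simp
qed

section \<open>Lelong numbers\<close>

lemma usc_attains_max:
  fixes f :: "'a::topological_space \<Rightarrow> 'b::linorder"
  assumes "compact K" "K \<noteq> {}"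
    and usc: "\<And>x c. x \<in> K \<Longrightarrow> f x < c \<Longrightarrow> \<forall>\<^sub>F y in at x. f y < c"
  shows "\<exists>x\<in>K. \<forall>y\<in>K. f y \<le> f x"
proof (rule ccontr)
  assume "\<not> ?thesis"
  then obtain m where m: "\<And>x. x \<in> K \<Longrightarrow> m x \<in> K" "\<And>x. x \<in> K \<Longrightarrow> f x < f (m x)"
    by (metis not_less)
  have "\<exists>V. open V \<and> x \<in> V \<and> (\<forall>y\<in>V. f y < f (m x))" if "x \<in> K" for x
    using usc[OF that m(2)[OF that]] m(2)[OF that] unfolding eventually_at_topological by (metis UNIV_I)
  then obtain V where V: "\<And>x. x \<in> K \<Longrightarrow> open (V x)" "\<And>x. x \<in> K \<Longrightarrow> x \<in> V x"
      "\<And>x y. x \<in> K \<Longrightarrow> y \<in> V x \<Longrightarrow> f y < f (m x)"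
    by metis
  obtain C where C: "C \<subseteq> K" "finite C" "K \<subseteq> (\<Union>x\<in>C. V x)"
    using compactE_image[OF \<open>compact K\<close>, of K V] V(1,2) by blast
  have "C \<noteq> {}" using C \<open>K \<noteq> {}\<close> by auto
  then have "Max ((\<lambda>x. f (m x)) ` C) \<in> (\<lambda>x. f (m x)) ` C"
    using C(2) by (intro Max_in) auto
  then obtain x where x: "x \<in> C" "f (m x) = Max ((\<lambda>x. f (m x)) ` C)" by auto
  obtain x' where "x' \<in> C" "m x \<in> V x'" using C m(1) x(1) by blast
  then have "f (m x) < f (m x')" using V(3) C(1) by blast
  moreover have "f (m x') \<le> f (m x)" unfolding x(2) using C(2) \<open>x' \<in> C\<close> by (intro Max_ge) auto
  ultimately show False by simp
qed

lemma circle_mean_le: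
  assumes le: "\<And>\<theta>. \<theta> \<in> {0..2*pi} \<Longrightarrow> u (z + cis \<theta> *s w) \<le> ereal (S \<theta>)"
    and S: "continuous_on {0..2*pi} S"
  shows "circle_mean u z w \<le> ereal (integral {0..2*pi} S / (2 * pi))"
proof -
  let ?I = "{0..2*pi}"
  let ?p = "integral ?I (\<lambda>\<theta>. max 0 (S \<theta>))" and ?n = "integral ?I (\<lambda>\<theta>. max 0 (- S \<theta>))"
  have c: "continuous_on ?I (\<lambda>\<theta>. max 0 (S \<theta>))" "continuous_on ?I (\<lambda>\<theta>. max 0 (- S \<theta>))"
    by (intro continuous_intros S)+
  have "(\<integral>\<^sup>+\<theta>\<in>?I. e2ennreal (u (z + cis \<theta> *s w)) \<partial>lborel) \<le> (\<integral>\<^sup>+\<theta>\<in>?I. ennreal (S \<theta>) \<partial>lborel)"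
    using e2ennreal_mono[OF le] by (intro nn_integral_mono) (auto simp: indicator_def)
  then have p: "enn2ereal (\<integral>\<^sup>+\<theta>\<in>?I. e2ennreal (u (z + cis \<theta> *s w)) \<partial>lborel) \<le> ereal ?p"
    using integral_nonneg[OF integrable_continuous_real[OF c(1)]]
    by (simp add: nn_integral_continuous_on[OF S] less_eq_ennreal.rep_eq)
  have "ereal (- S \<theta>) \<le> - u (z + cis \<theta> *s w)" if "\<theta> \<in> ?I" for \<theta>
    using le[OF that] by (metis ereal_minus_le_minus uminus_ereal.simps(1))
  then have "(\<integral>\<^sup>+\<theta>\<in>?I. ennreal (- S \<theta>) \<partial>lborel) \<le> (\<integral>\<^sup>+\<theta>\<in>?I. e2ennreal (- u (z + cis \<theta> *s w)) \<partial>lborel)"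
    using e2ennreal_mono by (intro nn_integral_mono) (fastforce simp: indicator_def)
  then have n: "ereal ?n \<le> enn2ereal (\<integral>\<^sup>+\<theta>\<in>?I. e2ennreal (- u (z + cis \<theta> *s w)) \<partial>lborel)"
    using integral_nonneg[OF integrable_continuous_real[OF c(2)]] continuous_on_minus[OF S]
    by (simp add: nn_integral_continuous_on less_eq_ennreal.rep_eq)
  have "?p - ?n = integral ?I (\<lambda>\<theta>. max 0 (S \<theta>) - max 0 (- S \<theta>))"
    by (rule integral_diff[symmetric]) (intro integrable_continuous_real c)+
  also have "\<dots> = integral ?I S" by (intro integral_cong) auto
  finally have "?p - ?n = integral ?I S" .
  then have "ereal (integral ?I S / (2 * pi)) = (ereal ?p - ereal ?n) / ereal (2 * pi)" by simp
  moreover have "circle_mean u z w \<le> (ereal ?p - ereal ?n) / ereal (2 * pi)"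
    unfolding circle_mean_def by (intro ereal_divide_right_mono ereal_minus_mono p n) simp
  ultimately show ?thesis by simp
qed

text \<open>The harmonic function \<open>- b ln |p + \<delta>\<zeta>| + \<eta> (|p + \<delta>\<zeta>|\<^sup>2 - \<delta>\<^sup>2 |\<zeta>|\<^sup>2)\<close> on the unit disc.\<close>

lemma circle_integral_log_barrier:
  fixes p :: complex and b \<eta> \<delta> :: real
  assumes \<delta>: "0 < \<delta>" "\<delta> < cmod p"
  shows "2 * pi * (\<eta> * (cmod p)\<^sup>2 - b * ln (cmod p) + \<eta> * \<delta>\<^sup>2) \<le>
    integral {0..2*pi} (\<lambda>\<theta>. \<eta> * (cmod (p + \<delta> * cis \<theta>))\<^sup>2 - b * ln (cmod (p + \<delta> * cis \<theta>)))"
proof -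
  define S :: "complex set" where "S = {\<zeta>. p + \<delta> * \<zeta> \<noteq> 0}"
  define X Y N :: "complex \<Rightarrow> real" where "X = (\<lambda>\<zeta>. Re p + \<delta> * Re \<zeta>)" and "Y = (\<lambda>\<zeta>. Im p + \<delta> * Im \<zeta>)"
    and "N = (\<lambda>\<zeta>. (X \<zeta>)\<^sup>2 + (Y \<zeta>)\<^sup>2)"
  have N: "0 < N \<zeta>" if "\<zeta> \<in> S" for \<zeta>
    using that by (auto simp: N_def X_def Y_def S_def complex_eq_iff sum_power2_gt_zero_iff)
  have cN: "(cmod (p + \<delta> * \<zeta>))\<^sup>2 = N \<zeta>" for \<zeta> :: complex by (simp add: cmod_power2 N_def X_def Y_def)
  have ln_N: "ln (cmod (p + \<delta> * \<zeta>)) = ln (N \<zeta>) / 2" for \<zeta> :: complex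
    unfolding cN[symmetric] by (cases "p + \<delta> * \<zeta> = 0") (simp_all add: ln_realpow)
  define g where "g = (\<lambda>\<zeta>. \<eta> * ((cmod p)\<^sup>2 + 2 * \<delta> * (Re p * Re \<zeta> + Im p * Im \<zeta>)) - b / 2 * ln (N \<zeta>))"
  have sub: "cball 0 1 \<subseteq> S"
  proof
    fix \<zeta> :: complex assume "\<zeta> \<in> cball 0 1"
    then have "cmod (\<delta> * \<zeta>) < cmod p"
      using \<delta> by (simp add: norm_mult) (metis mult.right_neutral mult_left_mono less_imp_le le_less_trans)
    then show "\<zeta> \<in> S" unfolding S_def by (smt (verit) add_eq_0_iff mem_Collect_eq norm_minus_cancel)
  qed
  have cont: "continuous_on S X" "continuous_on S Y" "continuous_on S N"
    by (auto simp: X_def Y_def N_def intro!: continuous_intros)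
  have "2 * pi * g 0 \<le> integral {0..2*pi} (\<lambda>\<theta>. g (cis \<theta>))"
  proof (rule circle_integral_ge_center[OF sub])
    fix \<zeta> assume \<zeta>: "\<zeta> \<in> S"
    note N = N[OF this]
    have dX: "(X has_derivative (\<lambda>h. \<delta> * Re h)) (at \<zeta>)" and dY: "(Y has_derivative (\<lambda>h. \<delta> * Im h)) (at \<zeta>)"
      unfolding X_def Y_def by (auto intro!: derivative_eq_intros)
    have dN: "(N has_derivative (\<lambda>h. 2 * \<delta> * (X \<zeta> * Re h + Y \<zeta> * Im h))) (at \<zeta>)"
      unfolding N_def by (rule derivative_eq_intros dX dY refl)+ (simp add: fun_eq_iff algebra_simps)
    have dquot: "((\<lambda>\<zeta>. c - b * \<delta> * Z \<zeta> / N \<zeta>) has_derivative (\<lambda>h. r * Re h + s * Im h)) (at \<zeta>)"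
      if Z: "(Z has_derivative Z') (at \<zeta>)"
        and eq: "\<And>h. - (b * \<delta> * (Z' h * N \<zeta> - Z \<zeta> * (2 * \<delta> * (X \<zeta> * Re h + Y \<zeta> * Im h)))) = (r * Re h + s * Im h) * (N \<zeta>)\<^sup>2"
      for Z Z' c r s
    proof -
      have "((\<lambda>\<zeta>. c - b * \<delta> * (Z \<zeta> / N \<zeta>)) has_derivative
        (\<lambda>h. 0 - b * \<delta> * ((Z' h * N \<zeta> - Z \<zeta> * (2 * \<delta> * (X \<zeta> * Re h + Y \<zeta> * Im h))) / (N \<zeta> * N \<zeta>)))) (at \<zeta>)"
        by (intro has_derivative_diff has_derivative_const has_derivative_mult_right has_derivative_divide' Z dN) (use N in simp)
      moreover have "0 - b * \<delta> * ((Z' h * N \<zeta> - Z \<zeta> * (2 * \<delta> * (X \<zeta> * Re h + Y \<zeta> * Im h))) / (N \<zeta> * N \<zeta>)) = r * Re h + s * Im h" for h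
        using eq[of h] N by (simp add: divide_simps power2_eq_square mult_ac)
      ultimately show ?thesis by simp
    qed
    show "(g has_derivative (\<lambda>h. (\<eta> * 2 * \<delta> * Re p - b * \<delta> * X \<zeta> / N \<zeta>) * Re h +
       (\<eta> * 2 * \<delta> * Im p - b * \<delta> * Y \<zeta> / N \<zeta>) * Im h)) (at \<zeta>)"
      unfolding g_def by (rule derivative_eq_intros refl dN N)+ (use N in \<open>auto simp: fun_eq_iff field_simps\<close>)
    show "((\<lambda>\<zeta>. \<eta> * 2 * \<delta> * Re p - b * \<delta> * X \<zeta> / N \<zeta>) has_derivative
      (\<lambda>h. (b * \<delta>\<^sup>2 * ((X \<zeta>)\<^sup>2 - (Y \<zeta>)\<^sup>2) / (N \<zeta>)\<^sup>2) * Re h + (b * \<delta>\<^sup>2 * 2 * X \<zeta> * Y \<zeta> / (N \<zeta>)\<^sup>2) * Im h)) (at \<zeta>)"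
      by (rule dquot[OF dX]) (use N in \<open>simp add: divide_simps, simp add: N_def power2_eq_square algebra_simps\<close>)
    show "((\<lambda>\<zeta>. \<eta> * 2 * \<delta> * Im p - b * \<delta> * Y \<zeta> / N \<zeta>) has_derivative
      (\<lambda>h. (b * \<delta>\<^sup>2 * 2 * X \<zeta> * Y \<zeta> / (N \<zeta>)\<^sup>2) * Re h + (b * \<delta>\<^sup>2 * ((Y \<zeta>)\<^sup>2 - (X \<zeta>)\<^sup>2) / (N \<zeta>)\<^sup>2) * Im h)) (at \<zeta>)"
      by (rule dquot[OF dY]) (use N in \<open>simp add: divide_simps, simp add: N_def power2_eq_square algebra_simps\<close>)
    show "0 \<le> b * \<delta>\<^sup>2 * ((X \<zeta>)\<^sup>2 - (Y \<zeta>)\<^sup>2) / (N \<zeta>)\<^sup>2 + b * \<delta>\<^sup>2 * ((Y \<zeta>)\<^sup>2 - (X \<zeta>)\<^sup>2) / (N \<zeta>)\<^sup>2"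
      by (simp add: add_divide_distrib[symmetric] distrib_left[symmetric])
  qed (auto intro!: continuous_intros cont dest: N)
  moreover have "g 0 = \<eta> * (cmod p)\<^sup>2 - b * ln (cmod p)"
    using ln_N[of 0] by (simp add: g_def)
  moreover have "g (cis \<theta>) = \<eta> * (cmod (p + \<delta> * cis \<theta>))\<^sup>2 - b * ln (cmod (p + \<delta> * cis \<theta>)) - \<eta> * \<delta>\<^sup>2" for \<theta>
  proof -
    have "N (cis \<theta>) = (cmod p)\<^sup>2 + 2 * \<delta> * (Re p * cos \<theta> + Im p * sin \<theta>) + \<delta>\<^sup>2 * ((cos \<theta>)\<^sup>2 + (sin \<theta>)\<^sup>2)"
      unfolding N_def X_def Y_def cmod_power2 cis.sel by algebra
    then have e: "(cmod p)\<^sup>2 + 2 * \<delta> * (Re p * cos \<theta> + Im p * sin \<theta>) = N (cis \<theta>) - \<delta>\<^sup>2" by simp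
    show ?thesis
      by (simp only: g_def cN ln_N cis.sel e) (simp add: algebra_simps)
  qed
  moreover have "integral {0..2*pi} (\<lambda>\<theta>. \<eta> * (cmod (p + \<delta> * cis \<theta>))\<^sup>2 - b * ln (cmod (p + \<delta> * cis \<theta>)) - \<eta> * \<delta>\<^sup>2)
     = integral {0..2*pi} (\<lambda>\<theta>. \<eta> * (cmod (p + \<delta> * cis \<theta>))\<^sup>2 - b * ln (cmod (p + \<delta> * cis \<theta>))) - 2 * pi * (\<eta> * \<delta>\<^sup>2)"
  proof (subst integral_diff)
    have "cis \<theta> \<in> S" for \<theta> using sub by auto
    then show "(\<lambda>\<theta>. \<eta> * (cmod (p + \<delta> * cis \<theta>))\<^sup>2 - b * ln (cmod (p + \<delta> * cis \<theta>))) integrable_on {0..2*pi}"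
      by (intro integrable_continuous_real continuous_intros) (auto simp: S_def cis_conv_exp intro!: continuous_intros)
  qed auto
  ultimately show ?thesis by (simp add: algebra_simps)
qed

lemma psh_on_less_top: "psh_on U u \<Longrightarrow> z \<in> U \<Longrightarrow> u z < \<infinity>"
  by (auto simp: psh_on_def)

lemma psh_on_usc: "psh_on U u \<Longrightarrow> z \<in> U \<Longrightarrow> u z < c \<Longrightarrow> \<forall>\<^sub>F y in at z. u y < c"
  by (auto simp: psh_on_def)

lemma psh_on_circle_mean:
  "psh_on U u \<Longrightarrow> (\<And>\<zeta>. cmod \<zeta> \<le> 1 \<Longrightarrow> z + \<zeta> *s w \<in> U) \<Longrightarrow> u z \<le> circle_mean u z w"
  unfolding psh_on_def by blast

text \<open>Otherwise \<open>u + \<eta> |\<zeta>|\<^sup>2 - b ln |\<zeta>|\<close> has an interior maximum for small \<open>\<eta> > 0\<close>, which is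
  impossible by strict subharmonicity.\<close>

lemma psh_annulus_log_bound:
  fixes u :: "complex^'n \<Rightarrow> ereal"
  assumes u: "psh_on U u" and r: "0 < r" "r < R"
    and U: "\<And>\<zeta>. cmod \<zeta> \<le> R \<Longrightarrow> a + \<zeta> *s w \<in> U"
    and bdr: "\<And>\<zeta>. cmod \<zeta> = r \<Longrightarrow> u (a + \<zeta> *s w) \<le> ereal (K + b * ln r)"
      "\<And>\<zeta>. cmod \<zeta> = R \<Longrightarrow> u (a + \<zeta> *s w) \<le> ereal (K + b * ln R)"
    and \<zeta>0: "r \<le> cmod \<zeta>0" "cmod \<zeta>0 \<le> R"
  shows "u (a + \<zeta>0 *s w) \<le> ereal (K + b * ln (cmod \<zeta>0))"
proof (rule ccontr)
  define f where "f = (\<lambda>\<zeta>. u (a + \<zeta> *s w))"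
  assume "\<not> ?thesis"
  moreover have "f \<zeta>0 < \<infinity>" unfolding f_def by (rule psh_on_less_top[OF u U[OF \<zeta>0(2)]])
  ultimately obtain m0 where m0: "f \<zeta>0 = ereal m0" "K + b * ln (cmod \<zeta>0) < m0"
    unfolding f_def by (cases "u (a + \<zeta>0 *s w)") auto
  define \<eta> where "\<eta> = (m0 - K - b * ln (cmod \<zeta>0)) / (2 * R\<^sup>2)"
  have \<eta>: "0 < \<eta>" "\<eta> * R\<^sup>2 < m0 - K - b * ln (cmod \<zeta>0)"
  proof -
    have "\<eta> * R\<^sup>2 = (m0 - K - b * ln (cmod \<zeta>0)) / 2" using r by (simp add: \<eta>_def)
    then show "\<eta> * R\<^sup>2 < m0 - K - b * ln (cmod \<zeta>0)" using m0(2) by simp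
    show "0 < \<eta>" using m0(2) r by (simp add: \<eta>_def)
  qed
  define g where "g = (\<lambda>\<zeta>. \<eta> * (cmod \<zeta>)\<^sup>2 - b * ln (cmod \<zeta>))"
  define A where "A = cball 0 R - ball (0::complex) r"
  have A: "\<zeta> \<in> A \<longleftrightarrow> r \<le> cmod \<zeta> \<and> cmod \<zeta> \<le> R" for \<zeta> by (auto simp: A_def)
  have "\<exists>x\<in>A. \<forall>y\<in>A. f y + ereal (g y) \<le> f x + ereal (g x)"
  proof (rule usc_attains_max)
    show "compact A" unfolding A_def by (intro compact_diff) auto
    show "A \<noteq> {}" using \<zeta>0 A by blast
    fix \<zeta> c assume \<zeta>: "\<zeta> \<in> A" and c: "f \<zeta> + ereal (g \<zeta>) < c"
    then have "f \<zeta> < c - ereal (g \<zeta>)" by (simp add: ereal_less_minus)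
    then obtain d where d: "f \<zeta> < d" "d < c - ereal (g \<zeta>)" using dense by blast
    obtain d' where d': "d = ereal d'" using d by (cases d) auto
    have "\<forall>\<^sub>F y in nhds (a + \<zeta> *s w). u y < d"
      using psh_on_usc[OF u U d(1)[unfolded f_def]] \<zeta> A d(1) unfolding f_def eventually_nhds_conv_at by auto
    moreover have "((\<lambda>\<zeta>. a + \<zeta> *s w) \<longlongrightarrow> a + \<zeta> *s w) (at \<zeta>)"
    proof -
      have "continuous_on UNIV (\<lambda>\<zeta>. a + \<zeta> *s w)" by (intro continuous_intros)
      then show ?thesis by (simp add: continuous_on_def)
    qed
    ultimately have 1: "\<forall>\<^sub>F x in at \<zeta>. f x < d"
      unfolding f_def by (rule eventually_compose_filterlim)
    have "\<zeta> \<noteq> 0" using \<zeta> A r by auto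
    then have "(g \<longlongrightarrow> g \<zeta>) (at \<zeta>)" unfolding g_def by (intro tendsto_intros) auto
    then have "((\<lambda>x. ereal (d' + g x)) \<longlongrightarrow> ereal (d' + g \<zeta>)) (at \<zeta>)" by (intro tendsto_intros)
    moreover have "ereal (d' + g \<zeta>) < c" using d(2) d' by (simp add: ereal_less_minus)
    ultimately have 2: "\<forall>\<^sub>F x in at \<zeta>. ereal (d' + g x) < c" by (rule order_tendstoD)
    show "\<forall>\<^sub>F x in at \<zeta>. f x + ereal (g x) < c"
      using 1 2
    proof eventually_elim
      case (elim x)
      have "f x + ereal (g x) \<le> d + ereal (g x)" using elim(1) by (intro add_right_mono) simp
      with elim(2) show ?case by (simp add: d')
    qed
  qed
  then obtain p where p: "p \<in> A" and max: "\<And>y. y \<in> A \<Longrightarrow> f y + ereal (g y) \<le> f p + ereal (g p)" by blast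
  have big: "ereal (K + \<eta> * R\<^sup>2) < f p + ereal (g p)"
  proof -
    have "0 \<le> \<eta> * (cmod \<zeta>0)\<^sup>2" using \<eta> by simp
    then have "K + \<eta> * R\<^sup>2 < m0 + g \<zeta>0" using \<eta>(2) by (simp add: g_def)
    then have "ereal (K + \<eta> * R\<^sup>2) < f \<zeta>0 + ereal (g \<zeta>0)" using m0(1) by simp
    also have "\<dots> \<le> f p + ereal (g p)" by (rule max) (use \<zeta>0 A in auto)
    finally show ?thesis .
  qed
  have "f p < \<infinity>" using p A unfolding f_def by (intro psh_on_less_top[OF u U]) auto
  with big obtain m where m: "f p = ereal m" by (cases "f p") auto
  have "(cmod p)\<^sup>2 \<le> R\<^sup>2" using p A by (intro power_mono) auto
  then have "g p \<le> \<eta> * R\<^sup>2 - b * ln (cmod p)" using \<eta> by (simp add: g_def)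
  with big m have mK: "K + b * ln (cmod p) < m" by simp
  have "cmod p \<noteq> r" "cmod p \<noteq> R"
    using bdr[of p] mK m by (auto simp: f_def)
  then have pA: "r < cmod p" "cmod p < R" using p A by auto
  define \<delta> where "\<delta> = min (cmod p - r) (R - cmod p)"
  have \<delta>: "0 < \<delta>" "\<delta> \<le> cmod p - r" "\<delta> \<le> R - cmod p" using pA by (auto simp: \<delta>_def)
  have disc: "p + \<delta> * \<zeta> \<in> A" if "cmod \<zeta> = 1" for \<zeta> :: complex
    using \<delta> that norm_triangle_ineq[of p "\<delta> * \<zeta>"] norm_triangle_ineq2[of p "- (\<delta> * \<zeta>)"]
    unfolding A by (auto simp: norm_mult)
  have line: "a + p *s w + \<zeta> *s (complex_of_real \<delta> *s w) = a + (p + \<delta> * \<zeta>) *s w" for \<zeta> :: complex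
    by (simp add: vec_eq_iff algebra_simps)
  let ?S = "\<lambda>\<theta>. m + g p - g (p + \<delta> * cis \<theta>)"
  have "p + \<delta> * cis \<theta> \<noteq> 0" for \<theta>
    using disc[of "cis \<theta>"] r(1) A by auto
  then have cg: "continuous_on {0..2*pi} (\<lambda>\<theta>. g (p + \<delta> * cis \<theta>))"
    unfolding g_def
    by (intro continuous_intros) (auto simp: cis_conv_exp intro!: continuous_intros)
  have "ereal m \<le> circle_mean u (a + p *s w) (complex_of_real \<delta> *s w)"
    unfolding m[symmetric] f_def
  proof (rule psh_on_circle_mean[OF u])
    fix \<zeta> :: complex assume "cmod \<zeta> \<le> 1"
    then have "cmod (\<delta> * \<zeta>) \<le> \<delta>" using \<delta> by (simp add: norm_mult mult_left_le)
    then have "cmod (p + \<delta> * \<zeta>) \<le> R" using norm_triangle_ineq[of p "\<delta> * \<zeta>"] \<delta> by linarith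
    then show "a + p *s w + \<zeta> *s (complex_of_real \<delta> *s w) \<in> U" unfolding line by (rule U)
  qed
  also have "\<dots> \<le> ereal (integral {0..2*pi} ?S / (2 * pi))"
  proof (rule circle_mean_le)
    fix \<theta>
    have "f (p + \<delta> * cis \<theta>) + ereal (g (p + \<delta> * cis \<theta>)) \<le> ereal (m + g p)"
      using max[OF disc[of "cis \<theta>"]] m by simp
    then have "f (p + \<delta> * cis \<theta>) \<le> ereal (?S \<theta>)"
      by (cases "f (p + \<delta> * cis \<theta>)") auto
    then show "u (a + p *s w + cis \<theta> *s (complex_of_real \<delta> *s w)) \<le> ereal (?S \<theta>)"
      unfolding line by (simp only: f_def)
  qed (intro continuous_intros cg)
  also have "integral {0..2*pi} ?S = 2 * pi * (m + g p) - integral {0..2*pi} (\<lambda>\<theta>. g (p + \<delta> * cis \<theta>))"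
    by (subst integral_diff) (auto intro!: integrable_continuous_real cg)
  finally have "2 * pi * m \<le> 2 * pi * (m + g p) - integral {0..2*pi} (\<lambda>\<theta>. g (p + \<delta> * cis \<theta>))"
    by (simp add: field_simps)
  moreover have "2 * pi * (g p + \<eta> * \<delta>\<^sup>2) \<le> integral {0..2*pi} (\<lambda>\<theta>. g (p + \<delta> * cis \<theta>))"
    unfolding g_def by (rule circle_integral_log_barrier) (use \<delta> r in auto)
  ultimately have "2 * pi * (\<eta> * \<delta>\<^sup>2) \<le> 0" by (simp add: algebra_simps)
  moreover have "0 < 2 * pi * (\<eta> * \<delta>\<^sup>2)" using \<eta>(1) \<delta>(1) by simp
  ultimately show False by simp
qed

lemma psh_three_balls:
  fixes u :: "complex^'n \<Rightarrow> ereal"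
  assumes u: "psh_on U u" and R: "cball a R \<subseteq> U" and r: "0 < r" "r < R"
    and \<alpha>: "\<And>y. y \<in> ball a r \<Longrightarrow> u y \<le> ereal \<alpha>" and \<beta>: "\<And>y. y \<in> ball a R \<Longrightarrow> u y \<le> ereal \<beta>"
    and z: "r \<le> dist a z" "dist a z < R"
  shows "u z \<le> ereal (\<alpha> + (\<beta> - \<alpha>) / (ln R - ln r) * (ln (dist a z) - ln r))"
proof -
  define b d where "b = (\<beta> - \<alpha>) / (ln R - ln r)" and "d = dist a z"
  have d: "0 < d" "r \<le> d" "d < R" using r z by (auto simp: d_def)
  have b: "b * (ln R - ln r) = \<beta> - \<alpha>" using r by (simp add: b_def)
  define w where "w = (1 / d) *\<^sub>R (z - a)"
  have nw: "norm w = 1" using d by (simp add: w_def d_def dist_norm norm_minus_commute)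
  have zw: "a + complex_of_real d *s w = z"
    using d by (simp add: w_def vec_eq_iff) (simp add: scaleR_conv_of_real)
  have dist_w: "dist a (a + \<zeta> *s w) = cmod \<zeta>" for \<zeta>
    by (simp add: dist_norm norm_vector_scalar_mult nw)
  have *: "u z \<le> ereal (\<alpha> + b * (ln d - ln r - ln \<tau>))" if \<tau>: "\<tau> \<in> {d / R<..<1}" for \<tau>
  proof -
    have \<tau>: "0 < \<tau>" "\<tau> < 1" "d < R * \<tau>" using \<tau> d by (auto simp: field_simps intro: less_trans[of 0 "d / R"])
    have "u (a + complex_of_real d *s w) \<le> ereal ((\<alpha> - b * ln (r * \<tau>)) + b * ln (cmod (complex_of_real d)))"
    proof (rule psh_annulus_log_bound[OF u])
      show "0 < r * \<tau>" "r * \<tau> < R * \<tau>" using r \<tau> by auto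
      have "r * \<tau> \<le> d" using d(2) mult_left_le[of \<tau> r] \<tau>(2) r(1) by linarith
      then show "r * \<tau> \<le> cmod (complex_of_real d)" by simp
      show "cmod (complex_of_real d) \<le> R * \<tau>" using d \<tau> by simp
      have "R * \<tau> < R" "r * \<tau> < r" using r \<tau> by auto
      show "a + \<zeta> *s w \<in> U" if "cmod \<zeta> \<le> R * \<tau>" for \<zeta>
        using R that \<open>R * \<tau> < R\<close> dist_w[of \<zeta>] by (intro subsetD[OF R]) simp
      show "u (a + \<zeta> *s w) \<le> ereal (\<alpha> - b * ln (r * \<tau>) + b * ln (r * \<tau>))" if "cmod \<zeta> = r * \<tau>" for \<zeta>
        using \<alpha>[of "a + \<zeta> *s w"] dist_w[of \<zeta>] that \<open>r * \<tau> < r\<close> by simp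
      have "\<alpha> - b * ln (r * \<tau>) + b * ln (R * \<tau>) = \<beta>"
        using b r \<tau> by (simp add: ln_mult algebra_simps)
      then show "u (a + \<zeta> *s w) \<le> ereal (\<alpha> - b * ln (r * \<tau>) + b * ln (R * \<tau>))" if "cmod \<zeta> = R * \<tau>" for \<zeta>
        using \<beta>[of "a + \<zeta> *s w"] dist_w[of \<zeta>] that \<open>R * \<tau> < R\<close> by simp
    qed
    then show ?thesis unfolding zw using r d \<tau> by (simp add: ln_mult algebra_simps)
  qed
  have "((\<lambda>\<tau>. ereal (\<alpha> + b * (ln d - ln r - ln \<tau>))) \<longlongrightarrow> ereal (\<alpha> + b * (ln d - ln r - ln 1))) (at_left 1)"
    by (intro tendsto_intros) auto
  moreover have "\<forall>\<^sub>F \<tau> in at_left 1. u z \<le> ereal (\<alpha> + b * (ln d - ln r - ln \<tau>))"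
    using eventually_at_left_real[of "d / R" 1] d by (auto elim!: eventually_mono intro: *)
  ultimately have "u z \<le> ereal (\<alpha> + b * (ln d - ln r - ln 1))"
    by (intro tendsto_lowerbound) auto
  then show ?thesis by (simp add: b_def d_def)
qed

lemma psh_bounded_above_ball:
  assumes u: "psh_on U u" and R: "cball a R \<subseteq> U" "0 \<le> R"
  shows "\<exists>c. \<forall>y\<in>cball a R. u y \<le> ereal c"
proof -
  have "\<exists>x\<in>cball a R. \<forall>y\<in>cball a R. u y \<le> u x"
    using R by (intro usc_attains_max psh_on_usc[OF u]) auto
  then obtain x where x: "x \<in> cball a R" "\<And>y. y \<in> cball a R \<Longrightarrow> u y \<le> u x" by blast
  have "u x < \<infinity>" using psh_on_less_top[OF u] x(1) R by blast
  then obtain c where "u x \<le> ereal c" by (cases "u x") auto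
  then show ?thesis using x(2) order_trans by blast
qed

text \<open>By \<open>psh_three_balls\<close> the slopes of the supremum over \<open>ball a r\<close> as a function of \<open>ln r\<close> are
  monotone, so the limit \<open>lelong_number u a\<close> exists; it is their infimum, or \<open>\<infinity>\<close> if \<open>u\<close> is \<open>- \<infinity>\<close> near \<open>a\<close>.\<close>

lemma lelong_number_pos_bound:
  fixes u :: "complex^'n \<Rightarrow> ereal"
  assumes u: "psh_on U u" and U: "open U" "a \<in> U" and pos: "0 < lelong_number u a"
  obtains \<nu> R C where "0 < \<nu>" "0 < R" "cball a R \<subseteq> U"
    "\<And>r y. 0 < r \<Longrightarrow> r < R \<Longrightarrow> y \<in> ball a r \<Longrightarrow> u y \<le> ereal (C + \<nu> * ln r)"
proof -
  obtain R where R: "0 < R" "cball a R \<subseteq> U" using U open_contains_cball by blast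
  obtain c where c: "\<And>y. y \<in> cball a R \<Longrightarrow> u y \<le> ereal c"
    using psh_bounded_above_ball[OF u R(2)] R(1) less_imp_le by blast
  define \<Phi> where "\<Phi> = (\<lambda>r. SUP z\<in>ball a r. u z)"
  show thesis
  proof (cases "\<exists>r0>0. \<Phi> r0 = - \<infinity>")
    case True
    then obtain r0 where r0: "r0 > 0" "\<Phi> r0 = - \<infinity>" by blast
    have "u y = - \<infinity>" if "y \<in> ball a r0" for y
      using r0(2) that SUP_upper[of y "ball a r0" u] by (simp add: \<Phi>_def)
    then show thesis using R r0(1) by (intro that[of 1 "min R r0" 0]) auto
  next
    case False
    define \<phi> where "\<phi> = (\<lambda>r. real_of_ereal (\<Phi> r))"
    have \<Phi>: "\<Phi> r = ereal (\<phi> r)" if "0 < r" "r \<le> R" for r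
    proof -
      have "\<Phi> r \<le> ereal c" unfolding \<Phi>_def by (intro SUP_least c) (use that in auto)
      moreover have "\<Phi> r \<noteq> - \<infinity>" using False that by blast
      ultimately show ?thesis by (cases "\<Phi> r") (auto simp: \<phi>_def)
    qed
    have u_le: "u y \<le> ereal (\<phi> r)" if "0 < r" "r \<le> R" "y \<in> ball a r" for r y
      using SUP_upper[OF that(3), of u] \<Phi>[OF that(1,2)] by (simp add: \<Phi>_def)
    have mono: "\<phi> r \<le> \<phi> s" if "0 < r" "r \<le> s" "s \<le> R" for r s
    proof -
      have "\<Phi> r \<le> \<Phi> s" unfolding \<Phi>_def by (intro SUP_subset_mono) (use that in auto)
      then show ?thesis using \<Phi>[of r] \<Phi>[of s] that by simp
    qed
    define \<sigma> where "\<sigma> = (\<lambda>r. (\<phi> R - \<phi> r) / (ln R - ln r))"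
    have \<phi>_eq: "\<phi> r = \<phi> R - \<sigma> r * (ln R - ln r)" if "0 < r" "r < R" for r
      using that by (simp add: \<sigma>_def)
    have \<sigma>_nonneg: "0 \<le> \<sigma> r" if "0 < r" "r < R" for r
      using that mono[of r R] by (simp add: \<sigma>_def)
    have \<sigma>_mono: "\<sigma> r \<le> \<sigma> s" if rs: "0 < r" "r \<le> s" "s < R" for r s
    proof -
      have "\<Phi> s \<le> ereal (\<phi> r + \<sigma> r * (ln s - ln r))"
        unfolding \<Phi>_def
      proof (rule SUP_least)
        fix y assume y: "y \<in> ball a s"
        have s0: "0 \<le> \<sigma> r" using \<sigma>_nonneg rs by simp
        show "u y \<le> ereal (\<phi> r + \<sigma> r * (ln s - ln r))"
        proof (cases "r \<le> dist a y")
          case True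
          have "u y \<le> ereal (\<phi> r + (\<phi> R - \<phi> r) / (ln R - ln r) * (ln (dist a y) - ln r))"
            by (rule psh_three_balls[OF u R(2) rs(1)]) (use rs y True in \<open>auto intro!: u_le\<close>)
          also have "\<dots> \<le> ereal (\<phi> r + \<sigma> r * (ln s - ln r))"
          proof -
            have "0 < dist a y" using True rs(1) by linarith
            then have "ln (dist a y) \<le> ln s" using y rs by simp
            moreover have "(\<phi> R - \<phi> r) / (ln R - ln r) = \<sigma> r" by (simp add: \<sigma>_def)
            ultimately show ?thesis using s0 by (simp add: mult_left_mono del: times_divide_eq_left)
          qed
          finally show ?thesis .
        next
          case False
          then have "u y \<le> ereal (\<phi> r)" using rs by (intro u_le) auto
          also have "\<dots> \<le> ereal (\<phi> r + \<sigma> r * (ln s - ln r))" using s0 rs by simp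
          finally show ?thesis .
        qed
      qed
      then have "\<phi> s \<le> \<phi> r + \<sigma> r * (ln s - ln r)" using \<Phi>[of s] rs by simp
      then have "\<sigma> r * (ln R - ln s) \<le> \<sigma> s * (ln R - ln s)"
        using \<phi>_eq[of r] \<phi>_eq[of s] rs by (simp add: algebra_simps)
      then show ?thesis using rs by simp
    qed
    define L where "L = Inf (\<sigma> ` {0<..<R})"
    have bdd: "bdd_below (\<sigma> ` {0<..<R})" using \<sigma>_nonneg by (intro bdd_belowI2[of _ 0]) auto
    have L_le: "L \<le> \<sigma> r" if "0 < r" "r < R" for r
      unfolding L_def by (rule cInf_lower[OF _ bdd]) (use that in auto)
    have lim_\<sigma>: "(\<sigma> \<longlongrightarrow> L) (at_right 0)"
    proof (rule order_tendstoI)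
      fix l assume "l < L"
      then show "\<forall>\<^sub>F r in at_right 0. l < \<sigma> r"
        using eventually_at_right_real[OF R(1)] L_le by (auto elim!: eventually_mono intro: less_le_trans)
    next
      fix l assume "L < l"
      then obtain r1 where r1: "0 < r1" "r1 < R" "\<sigma> r1 < l"
        using cInf_lessD[of "\<sigma> ` {0<..<R}" l] R(1) by (auto simp: L_def)
      show "\<forall>\<^sub>F r in at_right 0. \<sigma> r < l"
        using eventually_at_right_real[OF r1(1)]
      proof eventually_elim
        case (elim r)
        then show ?case using \<sigma>_mono[of r r1] r1 by simp
      qed
    qed
    have inv: "((\<lambda>r::real. inverse (ln r)) \<longlongrightarrow> 0) (at_right 0)"
      by (rule filterlim_compose[OF tendsto_inverse_0 filterlim_mono[OF ln_at_0 at_bot_le_at_infinity order_refl]])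
    have "((\<lambda>r. \<phi> R * inverse (ln r) - \<sigma> r * (ln R * inverse (ln r) - 1)) \<longlongrightarrow> \<phi> R * 0 - L * (ln R * 0 - 1)) (at_right 0)"
      by (intro tendsto_intros lim_\<sigma> inv)
    moreover have "\<forall>\<^sub>F r in at_right 0. \<phi> R * inverse (ln r) - \<sigma> r * (ln R * inverse (ln r) - 1) = \<phi> r / ln r"
    proof -
      have "\<forall>\<^sub>F r in at_right 0. r \<in> {0<..<min R 1}" using R(1) by (intro eventually_at_right_real) simp
      then show ?thesis
      proof eventually_elim
        case (elim r)
        then have "ln r < 0" by simp
        then show ?case using \<phi>_eq[of r] elim by (simp add: field_simps)
      qed
    qed
    ultimately have "((\<lambda>r. \<phi> r / ln r) \<longlongrightarrow> L) (at_right 0)"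
      by (simp add: tendsto_cong)
    then have "((\<lambda>r. ereal (\<phi> r / ln r)) \<longlongrightarrow> ereal L) (at_right 0)" by (intro tendsto_intros)
    moreover have "\<forall>\<^sub>F r in at_right 0. ereal (\<phi> r / ln r) = (SUP z\<in>ball a r. u z) / ereal (ln r)"
    proof -
      have "\<forall>\<^sub>F r in at_right 0. r \<in> {0<..<min R 1}" using R(1) by (intro eventually_at_right_real) simp
      then show ?thesis
      proof eventually_elim
        case (elim r)
        then have "ln r < 0" by simp
        then show ?case using \<Phi>[of r] elim by (simp add: \<Phi>_def)
      qed
    qed
    ultimately have "((\<lambda>r. (SUP z\<in>ball a r. u z) / ereal (ln r)) \<longlongrightarrow> ereal L) (at_right 0)"
      by (rule Lim_transform_eventually)
    then have "lelong_number u a = ereal L"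
      unfolding lelong_number_def by (intro tendsto_Lim) auto
    then have "0 < L" using pos by simp
    show thesis
    proof (rule that[of L R "\<phi> R - L * ln R"])
      fix r y assume r: "0 < r" "r < R" and y: "y \<in> ball a r"
      have "u y \<le> ereal (\<phi> r)" using r y by (intro u_le) auto
      also have "\<phi> r \<le> \<phi> R - L * ln R + L * ln r"
        using \<phi>_eq[OF r] mult_right_mono[OF L_le[OF r], of "ln R - ln r"] r by (simp add: algebra_simps)
      finally show "u y \<le> ereal (\<phi> R - L * ln R + L * ln r)" by simp
    qed (use R \<open>0 < L\<close> in auto)
  qed
qed

section \<open>Comparison with a logarithmic barrier\<close>

lemma Re_levi_form_nonneg: "positive_definite H \<Longrightarrow> 0 \<le> Re (levi_form H w)"
  by (cases "w = 0") (auto simp: positive_definite_def levi_form_def less_imp_le)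

lemma circle_integral_ge_center_SPSH:
  fixes g :: "complex^'n \<Rightarrow> real"
  assumes g: "SPSH X g" and \<Omega>: "open \<Omega>" "\<Omega> \<subseteq> X" and disc: "\<And>\<zeta>. cmod \<zeta> \<le> 1 \<Longrightarrow> z + \<zeta> *s w \<in> \<Omega>"
  shows "2 * pi * g z \<le> integral {0..2*pi} (\<lambda>\<theta>. g (z + cis \<theta> *s w))"
proof -
  obtain W where W: "open W" "X \<subseteq> W" "smooth_on W g"
    using g by (auto simp: SPSH_def C_infinity_def)
  note D = smooth_onD[OF W(3)]
  define S where "S = {\<zeta>. z + \<zeta> *s w \<in> \<Omega>}"
  have SW: "z + \<zeta> *s w \<in> W" if "\<zeta> \<in> S" for \<zeta> using that \<Omega> W by (auto simp: S_def)
  have chain: "((\<lambda>\<zeta>. k (z + \<zeta> *s w)) has_derivative (\<lambda>h. k' w * Re h + k' (\<i> *s w) * Im h)) (at \<zeta>)"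
    if k: "(k has_derivative k') (at (z + \<zeta> *s w))" for k :: "complex^'n \<Rightarrow> real" and k' \<zeta>
  proof -
    have eq: "k' (h *s w) = k' w * Re h + k' (\<i> *s w) * Im h" for h
    proof -
      have "h *s w = Re h *\<^sub>R w + Im h *\<^sub>R (\<i> *s w)"
        by (simp add: vec_eq_iff complex_eq_iff)
      then have "k' (h *s w) = k' (Re h *\<^sub>R w + Im h *\<^sub>R (\<i> *s w))" by (rule arg_cong)
      also have "\<dots> = k' w * Re h + k' (\<i> *s w) * Im h"
        using has_derivative_linear[OF k] by (simp add: linear_add linear_cmul)
      finally show ?thesis .
    qed
    have "linear (\<lambda>\<zeta>. \<zeta> *s w)"
      by (intro linearI) (simp_all add: vec_eq_iff algebra_simps)
    then have "((\<lambda>\<zeta>. z + \<zeta> *s w) has_derivative (\<lambda>h. 0 + h *s w)) (at \<zeta>)"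
      by (rule has_derivative_add[OF has_derivative_const linear_imp_has_derivative])
    from has_derivative_compose[OF this k] show ?thesis
      by (rule has_derivative_eq_rhs) (rule ext, subst add_0_left, rule eq)
  qed
  have cont: "continuous_on S (\<lambda>\<zeta>. k (z + \<zeta> *s w))" if "continuous_on W k" for k :: "complex^'n \<Rightarrow> real"
    by (rule continuous_on_compose2[OF that]) (auto intro!: continuous_intros SW)
  have "2 * pi * g (z + 0 *s w) \<le> integral {0..2*pi} (\<lambda>\<theta>. g (z + cis \<theta> *s w))"
  proof (rule circle_integral_ge_center[where S = S and g = "\<lambda>\<zeta>. g (z + \<zeta> *s w)"])
    show "cball 0 1 \<subseteq> S" using disc by (auto simp: S_def)
    fix \<zeta> assume "\<zeta> \<in> S"
    note x = SW[OF this]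
    show "((\<lambda>\<zeta>. g (z + \<zeta> *s w)) has_derivative (\<lambda>h. frechet_derivative g (at (z + \<zeta> *s w)) w * Re h
        + frechet_derivative g (at (z + \<zeta> *s w)) (\<i> *s w) * Im h)) (at \<zeta>)"
      by (rule chain[OF D(1)[OF x]])
    show "((\<lambda>\<zeta>. frechet_derivative g (at (z + \<zeta> *s w)) w) has_derivative
        (\<lambda>h. second_derivative g (z + \<zeta> *s w) w w * Re h + second_derivative g (z + \<zeta> *s w) w (\<i> *s w) * Im h)) (at \<zeta>)"
      by (rule chain[OF D(2)[OF x]])
    show "((\<lambda>\<zeta>. frechet_derivative g (at (z + \<zeta> *s w)) (\<i> *s w)) has_derivative
        (\<lambda>h. second_derivative g (z + \<zeta> *s w) (\<i> *s w) w * Re h + second_derivative g (z + \<zeta> *s w) (\<i> *s w) (\<i> *s w) * Im h)) (at \<zeta>)"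
      by (rule chain[OF D(2)[OF x]])
    have "positive_definite (complex_hessian g (z + \<zeta> *s w))"
      using g \<open>\<zeta> \<in> S\<close> \<Omega> by (auto simp: SPSH_def S_def)
    then show "0 \<le> second_derivative g (z + \<zeta> *s w) w w + second_derivative g (z + \<zeta> *s w) (\<i> *s w) (\<i> *s w)"
      using Re_levi_form_complex_hessian[OF W(1) x W(3), of w] Re_levi_form_nonneg by (metis zero_le_divide_iff zero_le_numeral not_numeral_le_zero)
  qed (rule cont[OF D(3)])+
  then show ?thesis by simp
qed

lemma SPSH_le_of_L1_close:
  fixes g :: "complex^'n \<Rightarrow> real"
  assumes g: "SPSH (closure \<Omega>) g" and \<Omega>: "open \<Omega>" "ball z r \<subseteq> \<Omega>" and r: "0 < r"
    and u0: "\<And>y. y \<in> ball z r \<Longrightarrow> u0 y \<le> ereal K"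
    and L1: "(\<integral>\<^sup>+y\<in>\<Omega>. e2ennreal \<bar>ereal (g y) - u0 y\<bar> \<partial>lborel) \<le> emeasure lborel (ball (0 :: complex^'n) r)"
  shows "g z \<le> K + 1"
proof -
  let ?V = "emeasure lborel (ball z r)"
  obtain W where W: "open W" "closure \<Omega> \<subseteq> W" "smooth_on W g"
    using g by (auto simp: SPSH_def C_infinity_def)
  have cont: "continuous_on (ball z r) g"
    using smooth_onD(4)[OF W(3)] W(2) \<Omega> closure_subset by (metis continuous_on_subset order_trans)
  have "ennreal (g z - K) * ?V \<le> (\<integral>\<^sup>+y\<in>ball z r. ennreal (g y - K) \<partial>lborel)"
  proof (rule submean_ball)
    fix w :: "complex^'n" assume w: "w \<in> ball 0 r"
    have disc: "z + \<zeta> *s w \<in> ball z r" if "cmod \<zeta> \<le> 1" for \<zeta>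
    proof -
      have "cmod \<zeta> * norm w \<le> 1 * norm w" using that by (intro mult_right_mono) auto
      then show ?thesis using w by (simp add: dist_norm norm_vector_scalar_mult)
    qed
    have "2 * pi * g z \<le> integral {0..2*pi} (\<lambda>\<theta>. g (z + cis \<theta> *s w))"
      by (rule circle_integral_ge_center_SPSH[OF g \<Omega>(1) closure_subset]) (use disc \<Omega>(2) in blast)
    moreover have "(\<lambda>\<theta>. g (z + cis \<theta> *s w)) integrable_on {0..2*pi}"
      by (intro integrable_continuous_real continuous_on_compose2[OF cont])
        (use disc in \<open>auto simp: cis_conv_exp intro!: continuous_intros\<close>)
    ultimately show "2 * pi * (g z - K) \<le> integral {0..2*pi} (\<lambda>\<theta>. g (z + cis \<theta> *s w) - K)"
      by (subst integral_diff) (auto simp: algebra_simps)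
  qed (intro continuous_intros cont)
  also have "\<dots> \<le> (\<integral>\<^sup>+y\<in>\<Omega>. e2ennreal \<bar>ereal (g y) - u0 y\<bar> \<partial>lborel)"
  proof (rule nn_integral_mono)
    fix y
    have "ennreal (g y - K) \<le> e2ennreal \<bar>ereal (g y) - u0 y\<bar>" if "y \<in> ball z r"
      using u0[OF that] by (cases "u0 y") (auto simp: e2ennreal_infty intro!: ennreal_leI)
    then show "ennreal (g y - K) * indicator (ball z r) y \<le> e2ennreal \<bar>ereal (g y) - u0 y\<bar> * indicator \<Omega> y"
      using \<Omega>(2) by (auto simp: indicator_def)
  qed
  also have "\<dots> \<le> ?V" using L1 r by (simp add: emeasure_ball)
  finally have "?V * ennreal (g z - K) \<le> ?V * 1" by (simp add: mult.commute)
  moreover have "?V \<noteq> 0" using content_ball_pos[OF r, of z] by (auto simp: measure_def)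
  moreover have "?V \<noteq> top" using emeasure_lborel_ball_finite[of z r] by simp
  ultimately have "ennreal (g z - K) \<le> 1" by (simp add: ennreal_mult_le_mult_iff del: mult_1_right)
  then show ?thesis by simp
qed

lemma second_derivative_le_of_touching:
  fixes h :: "real \<Rightarrow> real"
  assumes e: "0 < e"
    and h: "\<And>s. \<bar>s\<bar> < e \<Longrightarrow> (h has_real_derivative h1 s) (at s)"
    and h1: "(h1 has_real_derivative h2) (at 0)"
    and le: "\<And>s. \<bar>s\<bar> < e \<Longrightarrow> h s \<le> h 0 + l * s + m * s\<^sup>2"
  shows "h2 \<le> 2 * m"
proof (rule ccontr)
  assume neg: "\<not> ?thesis"
  define k where "k = (\<lambda>s. h s - l * s - m * s\<^sup>2)"
  define k1 where "k1 = (\<lambda>s. h1 s - l - 2 * m * s)"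
  have k: "(k has_real_derivative k1 s) (at s)" if "\<bar>s\<bar> < e" for s
    unfolding k_def k1_def by (rule derivative_eq_intros h[OF that] refl)+ simp
  have "(k1 has_real_derivative h2 - 2 * m) (at 0)"
    unfolding k1_def by (rule derivative_eq_intros h1 refl)+ simp
  then obtain d where d: "d > 0" "\<And>t. 0 < t \<Longrightarrow> t < d \<Longrightarrow> k1 0 < k1 (0 + t)"
    using DERIV_pos_inc_right[of k1 "h2 - 2 * m" 0] neg by auto
  have max: "k s \<le> k 0" if "\<bar>s\<bar> < e" for s
    using le[OF that] by (simp add: k_def)
  have "k1 0 = 0"
    by (rule DERIV_local_max[OF k e]) (use e max in auto)
  define t where "t = min d e / 2"
  have t: "0 < t" "t < d" "t < e" using d e by (auto simp: t_def)
  have "\<exists>c. 0 < c \<and> c < t \<and> k t - k 0 = (t - 0) * k1 c"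
    by (rule MVT2) (use t k in auto)
  then obtain c where c: "0 < c" "c < t" "k t - k 0 = t * k1 c" by auto
  then have "0 < t * k1 c" using d(2)[of c] t \<open>k1 0 = 0\<close> by simp
  then show False using c(3) max[of t] t by simp
qed

lemma Re_levi_form_le_of_touching:
  fixes g :: "complex^'n \<Rightarrow> real"
  assumes W: "open W" "z \<in> W" "smooth_on W g" and e: "0 < e" "ball z e \<subseteq> W"
    and \<epsilon>: "0 < \<epsilon>" and \<kappa>: "0 \<le> \<kappa>"
    and touch: "\<And>x. x \<in> ball z e \<Longrightarrow>
      g x \<le> g z + \<kappa> / 2 * (ln ((norm (x - a))\<^sup>2 + \<epsilon>) - ln ((norm (z - a))\<^sup>2 + \<epsilon>))"
  shows "Re (levi_form (complex_hessian g z) w) \<le> \<kappa> / (2 * ((norm (z - a))\<^sup>2 + \<epsilon>)) * (norm w)\<^sup>2"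
proof -
  note D = smooth_onD[OF W(3)]
  define q where "q = (norm (z - a))\<^sup>2 + \<epsilon>"
  have q: "0 < q" using \<epsilon> by (simp add: q_def add_nonneg_pos)
  have ln_diff: "ln (q + x) - ln q \<le> x / q" if "0 < q + x" for x
  proof -
    have "ln ((q + x) / q) \<le> (q + x) / q - 1" using q that by (intro ln_le_minus_one) simp
    moreover have "ln ((q + x) / q) = ln (q + x) - ln q" using q that by (subst ln_div) auto
    moreover have "(q + x) / q - 1 = x / q" using q by (simp add: field_simps)
    ultimately show ?thesis by simp
  qed
  have *: "second_derivative g z v v \<le> \<kappa> / q * (norm v)\<^sup>2" for v
  proof -
    define e' where "e' = e / (norm v + 1)"
    have e': "0 < e'" using e by (simp add: e'_def add_nonneg_pos)
    have in_ball: "z + s *\<^sub>R v \<in> ball z e" if "\<bar>s\<bar> < e'" for s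
    proof -
      have "\<bar>s\<bar> * norm v \<le> \<bar>s\<bar> * (norm v + 1)" by (intro mult_left_mono) auto
      also have "\<dots> < e" using that by (simp add: e'_def pos_less_divide_eq add_nonneg_pos)
      finally show ?thesis by (simp add: dist_norm)
    qed
    have chain: "((\<lambda>s. k (z + s *\<^sub>R v)) has_real_derivative k' v) (at s)"
      if k: "(k has_derivative k') (at (z + s *\<^sub>R v))" for k :: "complex^'n \<Rightarrow> real" and k' s
    proof -
      have "((\<lambda>s. z + s *\<^sub>R v) has_derivative (\<lambda>h. h *\<^sub>R v)) (at s)"
        by (auto intro!: derivative_eq_intros)
      from has_derivative_compose[OF this k] show ?thesis
        unfolding has_field_derivative_def
        by (rule has_derivative_eq_rhs) (simp add: linear_cmul[OF has_derivative_linear[OF k]] fun_eq_iff mult.commute)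
    qed
    have "second_derivative g z v v \<le> 2 * (\<kappa> / (2 * q) * (norm v)\<^sup>2)"
    proof (rule second_derivative_le_of_touching[OF e'])
      show "((\<lambda>s. g (z + s *\<^sub>R v)) has_real_derivative frechet_derivative g (at (z + s *\<^sub>R v)) v) (at s)" if "\<bar>s\<bar> < e'" for s
        by (rule chain[OF D(1)]) (use in_ball[OF that] e(2) in blast)
      show "((\<lambda>s. frechet_derivative g (at (z + s *\<^sub>R v)) v) has_real_derivative second_derivative g z v v) (at 0)"
        using chain[of "\<lambda>x. frechet_derivative g (at x) v" "second_derivative g z v" 0] D(2)[OF W(2), of v] by simp
      fix s assume "\<bar>s\<bar> < e'"
      have "(norm (z + s *\<^sub>R v - a))\<^sup>2 = (norm (z - a))\<^sup>2 + 2 * s * ((z - a) \<bullet> v) + s\<^sup>2 * (norm v)\<^sup>2"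
        unfolding power2_norm_eq_inner by (simp add: inner_simps inner_commute algebra_simps power2_eq_square)
      then have N: "(norm (z + s *\<^sub>R v - a))\<^sup>2 + \<epsilon> = q + (2 * s * ((z - a) \<bullet> v) + s\<^sup>2 * (norm v)\<^sup>2)"
        by (simp add: q_def)
      let ?x = "2 * s * ((z - a) \<bullet> v) + s\<^sup>2 * (norm v)\<^sup>2"
      have pos: "0 < q + ?x" using N \<epsilon> by (metis add_nonneg_pos zero_le_power2)
      from ln_diff[OF this]
      have "\<kappa> / 2 * (ln (q + ?x) - ln q) \<le> \<kappa> / 2 * (?x / q)" using \<kappa> by (intro mult_left_mono) auto
      with touch[OF in_ball[OF \<open>\<bar>s\<bar> < e'\<close>]]
      have "g (z + s *\<^sub>R v) \<le> g z + \<kappa> / 2 * (?x / q)" unfolding N q_def[symmetric] by linarith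
      also have "\<dots> = g (z + 0 *\<^sub>R v) + (\<kappa> / q * ((z - a) \<bullet> v)) * s + \<kappa> / (2 * q) * (norm v)\<^sup>2 * s\<^sup>2"
        using q by (simp add: field_simps)
      finally show "g (z + s *\<^sub>R v) \<le> g (z + 0 *\<^sub>R v) + (\<kappa> / q * ((z - a) \<bullet> v)) * s + \<kappa> / (2 * q) * (norm v)\<^sup>2 * s\<^sup>2" .
    qed
    then show ?thesis by simp
  qed
  have "norm (\<i> *s w) = norm w" by (simp add: norm_vector_scalar_mult)
  then show ?thesis
    using *[of w] *[of "\<i> *s w"] q
    unfolding Re_levi_form_complex_hessian[OF W] q_def[symmetric] by (simp add: field_simps)
qed

lemma ln_det_hessian_le_of_touching:
  fixes g :: "complex^'n \<Rightarrow> real"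
  assumes g: "SPSH X g" and z: "z \<in> X" and e: "0 < e"
    and \<epsilon>: "0 < \<epsilon>" "(norm (z - a))\<^sup>2 + \<epsilon> < 1" and \<kappa>: "0 < \<kappa>" "\<kappa> \<le> \<nu>"
    and touch: "\<And>x. x \<in> ball z e \<Longrightarrow>
      g x \<le> g z + \<kappa> / 2 * (ln ((norm (x - a))\<^sup>2 + \<epsilon>) - ln ((norm (z - a))\<^sup>2 + \<epsilon>))"
  shows "ln (Re (det (complex_hessian g z))) \<le>
    max 0 (ln (fact CARD('n)) + CARD('n) * ln (2 * \<nu>)) - CARD('n) * ln ((norm (z - a))\<^sup>2 + \<epsilon>)"
proof -
  let ?H = "complex_hessian g z" and ?n = "CARD('n)"
  define q where "q = (norm (z - a))\<^sup>2 + \<epsilon>"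
  have q: "0 < q" "q < 1" using \<epsilon> by (simp_all add: q_def add_nonneg_pos)
  obtain W where W: "open W" "X \<subseteq> W" "smooth_on W g"
    using g by (auto simp: SPSH_def C_infinity_def)
  have "z \<in> W" using W z by blast
  then obtain e2 where e2: "e2 > 0" "ball z e2 \<subseteq> W" using W open_contains_ball by metis
  have "Re (levi_form ?H w) \<le> \<kappa> / (2 * q) * (norm w)\<^sup>2" for w
    unfolding q_def
    by (rule Re_levi_form_le_of_touching[OF W(1) \<open>z \<in> W\<close> W(3), where e = "min e e2"])
      (use e e2 \<epsilon> \<kappa> touch in auto)
  moreover have "positive_definite ?H" using g z by (auto simp: SPSH_def)
  ultimately have "cmod (det ?H) \<le> fact ?n * (4 * (\<kappa> / (2 * q))) ^ ?n"
    by (intro positive_definite_det_le)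
  also have "\<dots> \<le> fact ?n * (2 * \<nu> / q) ^ ?n"
    using \<kappa> q by (intro mult_left_mono power_mono) (auto simp: divide_simps)
  finally have det: "\<bar>Re (det ?H)\<bar> \<le> fact ?n * (2 * \<nu> / q) ^ ?n"
    using abs_Re_le_cmod order_trans by blast
  have ln_rhs: "ln (fact ?n * (2 * \<nu> / q) ^ ?n) = ln (fact ?n) + ?n * ln (2 * \<nu>) - ?n * ln q"
    using \<kappa> q by (simp add: ln_mult ln_div ln_realpow algebra_simps)
  have "0 \<le> - (?n * ln q)" using q by (simp add: mult_nonneg_nonpos)
  moreover have "ln (Re (det ?H)) \<le> ln (fact ?n * (2 * \<nu> / q) ^ ?n)" if "Re (det ?H) \<noteq> 0"
  proof -
    have "ln (Re (det ?H)) = ln \<bar>Re (det ?H)\<bar>" by (simp add: abs_if ln_minus)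
    also have "\<dots> \<le> ln (fact ?n * (2 * \<nu> / q) ^ ?n)"
      using det that by (intro ln_mono) auto
    finally show ?thesis .
  qed
  ultimately show ?thesis
    unfolding q_def[symmetric] ln_rhs by (cases "Re (det ?H) = 0") auto
qed

lemma C_infinity_continuous_on: "C_infinity S g \<Longrightarrow> continuous_on S g"
  unfolding C_infinity_def using smooth_onD(4) continuous_on_subset by blast

theorem theorem1p3:
  fixes A T :: real
    and \<Omega> :: "(complex^'n) set"
    and \<phi> f :: "(complex^'n) \<times> real \<Rightarrow> real"
    and u0 :: "complex^'n \<Rightarrow> ereal"
  assumes "0 \<le> A" and "0 < T"
    and "strictly_pseudoconvex_domain \<Omega>"
    and "C_infinity (closure \<Omega> \<times> {0..T}) \<phi>"
    and "C_infinity (closure \<Omega> \<times> {0..T}) f"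
    and "\<exists>U. open U \<and> closure \<Omega> \<subseteq> U \<and> psh_on U u0"
    and "\<forall>z\<in>frontier \<Omega>. u0 z = ereal (\<phi> (z, 0))"
    and "\<exists>a\<in>\<Omega>. 0 < lelong_number u0 a"
  shows "\<not> (\<exists>u :: (complex^'n) \<times> real \<Rightarrow> real.
      C_infinity (closure \<Omega> \<times> {0<..<T}) u \<and>
      (\<forall>t\<in>{0<..<T}. SPSH (closure \<Omega>) (\<lambda>z. u (z, t))) \<and>
      (\<forall>z\<in>closure \<Omega>. \<forall>t\<in>{0<..<T}.
         ((\<lambda>s. u (z, s)) has_real_derivative
            ln (Re (det (complex_hessian (\<lambda>w. u (w, t)) z))) - A * u (z, t) + f (z, t)) (at t)) \<and>
      (\<forall>z\<in>frontier \<Omega>. \<forall>t\<in>{0<..<T}. u (z, t) = \<phi> (z, t)) \<and>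
      ((\<lambda>t. \<integral>\<^sup>+z\<in>\<Omega>. e2ennreal \<bar>ereal (u (z, t)) - u0 z\<bar> \<partial>lborel) \<longlongrightarrow> 0) (at_right 0))"
proof
  let ?n = "CARD('n)"
  assume "\<exists>u :: (complex^'n) \<times> real \<Rightarrow> real.
      C_infinity (closure \<Omega> \<times> {0<..<T}) u \<and>
      (\<forall>t\<in>{0<..<T}. SPSH (closure \<Omega>) (\<lambda>z. u (z, t))) \<and>
      (\<forall>z\<in>closure \<Omega>. \<forall>t\<in>{0<..<T}.
         ((\<lambda>s. u (z, s)) has_real_derivative
            ln (Re (det (complex_hessian (\<lambda>w. u (w, t)) z))) - A * u (z, t) + f (z, t)) (at t)) \<and>
      (\<forall>z\<in>frontier \<Omega>. \<forall>t\<in>{0<..<T}. u (z, t) = \<phi> (z, t)) \<and>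
      ((\<lambda>t. \<integral>\<^sup>+z\<in>\<Omega>. e2ennreal \<bar>ereal (u (z, t)) - u0 z\<bar> \<partial>lborel) \<longlongrightarrow> 0) (at_right 0)"
  then obtain u :: "(complex^'n) \<times> real \<Rightarrow> real" where
    u_cont: "continuous_on (closure \<Omega> \<times> {0<..<T}) u" and
    u_spsh: "\<And>t. t \<in> {0<..<T} \<Longrightarrow> SPSH (closure \<Omega>) (\<lambda>z. u (z, t))" and
    u_eq: "\<And>z t. z \<in> closure \<Omega> \<Longrightarrow> t \<in> {0<..<T} \<Longrightarrow> ((\<lambda>s. u (z, s)) has_real_derivative
            ln (Re (det (complex_hessian (\<lambda>w. u (w, t)) z))) - A * u (z, t) + f (z, t)) (at t)" and
    u_lim: "((\<lambda>t. \<integral>\<^sup>+z\<in>\<Omega>. e2ennreal \<bar>ereal (u (z, t)) - u0 z\<bar> \<partial>lborel) \<longlongrightarrow> 0) (at_right 0)"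
    using C_infinity_continuous_on by blast
  have \<Omega>: "open \<Omega>" "compact (closure \<Omega>)"
    using assms(3) by (auto simp: strictly_pseudoconvex_domain_def)
  obtain a where a: "a \<in> \<Omega>" "0 < lelong_number u0 a" using assms(8) by blast
  obtain U where U: "open U" "closure \<Omega> \<subseteq> U" "psh_on U u0" using assms(6) by blast
  have "a \<in> U" using a U closure_subset by blast
  obtain \<nu> R C where \<nu>: "0 < \<nu>" "0 < R" and "cball a R \<subseteq> U" and
    u0_le: "\<And>r y. 0 < r \<Longrightarrow> r < R \<Longrightarrow> y \<in> ball a r \<Longrightarrow> u0 y \<le> ereal (C + \<nu> * ln r)"
    by (rule lelong_number_pos_bound[OF U(3,1) \<open>a \<in> U\<close> a(2)]) (rule that)
  obtain e where e: "0 < e" "ball a e \<subseteq> \<Omega>" using \<Omega>(1) a(1) open_contains_ball by blast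
  define d where "d = min (min e R) (1/2) / 3"
  have d: "0 < d" "2 * d < R" "2 * d < e" "2 * d < 1/2" using \<nu> e by (auto simp: d_def min_def)
  have ball_sub: "ball z r \<subseteq> ball a (dist z a + r)" for z r
  proof
    fix y assume "y \<in> ball z r"
    then show "y \<in> ball a (dist z a + r)" using dist_triangle[of a y z] by (simp add: dist_commute)
  qed
  have ball_\<Omega>: "ball z d \<subseteq> \<Omega>" if "z \<in> cball a d" for z
  proof -
    have "ball a (dist z a + d) \<subseteq> ball a e" using that d(3) by (intro subset_ball) (simp add: dist_commute)
    then show ?thesis using ball_sub[of z d] e(2) by blast
  qed
  have cball_\<Omega>: "cball a d \<subseteq> \<Omega>"
    using ball_\<Omega> d(1) by (meson centre_in_ball subset_iff)
  let ?V = "\<lambda>r. emeasure lborel (ball (0::complex^'n) r)"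
  define I where "I = (\<lambda>t. \<integral>\<^sup>+z\<in>\<Omega>. e2ennreal \<bar>ereal (u (z, t)) - u0 z\<bar> \<partial>lborel)"
  have u_le: "u (z, t) \<le> C + \<nu> * ln (dist z a + r) + 1"
    if z: "z \<in> cball a d" and r: "0 < r" "r \<le> d" and t: "t \<in> {0<..<T}" and I: "I t \<le> ?V r" for z r t
  proof (rule SPSH_le_of_L1_close[OF u_spsh[OF t] \<Omega>(1) _ r(1)])
    show "ball z r \<subseteq> \<Omega>" using ball_\<Omega>[OF z] r by auto
    show "u0 y \<le> ereal (C + \<nu> * ln (dist z a + r))" if "y \<in> ball z r" for y
    proof (rule u0_le)
      show "y \<in> ball a (dist z a + r)" using that ball_sub[of z r] by blast
      show "0 < dist z a + r" using r by (simp add: add_nonneg_pos)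
      show "dist z a + r < R" using z r d(2) by (simp add: dist_commute)
    qed
  qed (use I in \<open>simp add: I_def\<close>)
  have I_small: "\<forall>\<^sub>F t in at_right 0. I t < ?V r" if "0 < r" for r
  proof -
    have "0 < ?V r" using content_ball_pos[OF that, of "0::complex^'n"] by (auto simp: measure_def zero_less_iff_neq_zero)
    then show ?thesis using order_tendstoD(2)[OF u_lim] by (simp add: I_def)
  qed
  then obtain t1' where t1': "0 < t1'" "\<And>t. 0 < t \<Longrightarrow> t < t1' \<Longrightarrow> I t < ?V d"
    using d(1) unfolding eventually_at_right_field by metis
  have "compact (f ` (closure \<Omega> \<times> {0..T}))"
    using \<Omega>(2) C_infinity_continuous_on[OF assms(5)] by (intro compact_continuous_image compact_Times) auto
  then obtain F where F: "\<And>z t. z \<in> closure \<Omega> \<Longrightarrow> t \<in> {0..T} \<Longrightarrow> f (z, t) \<le> F"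
    using bounded_imp_bdd_above[OF compact_imp_bounded] unfolding bdd_above_def by fastforce

  define c where "c = 2 * ?n + A * \<nu>"
  define C1 where "C1 = max 0 (ln (fact ?n) + ?n * ln (2 * \<nu>))"
  define C0 where "C0 = \<bar>C\<bar> + \<nu> / 2 * ln 2 + 1 - \<nu> * ln d"
  define C2 where "C2 = C1 + \<bar>F\<bar> + 1"
  have "0 < c" using assms(1) \<nu>(1) by (simp add: c_def add_pos_nonneg)
  have "0 < C2" by (simp add: C2_def C1_def)
  have "\<nu> * ln d \<le> 0" using d \<nu> by (simp add: mult_nonneg_nonpos)
  moreover have "0 \<le> \<nu> / 2 * ln 2" using \<nu> by simp
  ultimately have "0 \<le> C0" and C0_ge: "C + \<nu> / 2 * ln 2 + 1 \<le> C0" "C + 1 - \<nu> * ln d \<le> C0"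
    unfolding C0_def using abs_ge_self[of C] by linarith+
  define t1 where "t1 = min (min t1' T) (\<nu> / c) / 2"
  have t1: "0 < t1" "t1 < t1'" "t1 < T" "t1 < \<nu> / c"
  proof -
    have "0 < \<nu> / c" using \<nu>(1) \<open>0 < c\<close> by simp
    moreover define m where "m = min (min t1' T) (\<nu> / c)"
    ultimately have "0 < m" "m \<le> t1'" "m \<le> T" "m \<le> \<nu> / c" using t1'(1) assms(2) by auto
    moreover have "t1 = m / 2" by (simp add: t1_def m_def)
    ultimately show "0 < t1" "t1 < t1'" "t1 < T" "t1 < \<nu> / c" by linarith+
  qed
  define \<kappa> where "\<kappa> = (\<lambda>t. \<nu> - c * t)"
  have \<kappa>: "0 < \<kappa> t" "\<kappa> t \<le> \<nu>" if "0 \<le> t" "t \<le> t1" for t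
  proof -
    have "t < \<nu> / c" using that(2) t1(4) by simp
    then have "c * t < \<nu>" using \<open>0 < c\<close> by (simp add: pos_less_divide_eq mult.commute)
    then show "0 < \<kappa> t" "\<kappa> t \<le> \<nu>" using that \<open>0 < c\<close> by (auto simp: \<kappa>_def)
  qed
  define \<psi> where "\<psi> = (\<lambda>\<epsilon> z t. \<kappa> t / 2 * ln ((norm (z - a))\<^sup>2 + \<epsilon>) + C0 + C2 * t)"
  have \<psi>_ge: "\<nu> / 2 * ln ((norm (z - a))\<^sup>2 + \<epsilon>) + C0 \<le> \<psi> \<epsilon> z t"
    if "0 < \<epsilon>" "(norm (z - a))\<^sup>2 + \<epsilon> < 1" "0 \<le> t" "t \<le> t1" for z \<epsilon> t
  proof -
    have "ln ((norm (z - a))\<^sup>2 + \<epsilon>) \<le> 0" using that by (simp add: add_nonneg_pos)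
    then have "\<nu> / 2 * ln ((norm (z - a))\<^sup>2 + \<epsilon>) \<le> \<kappa> t / 2 * ln ((norm (z - a))\<^sup>2 + \<epsilon>)"
      using \<kappa>[OF that(3,4)] by (intro mult_right_mono_neg) auto
    moreover have "0 \<le> C2 * t" using \<open>0 < C2\<close> that by simp
    ultimately show ?thesis by (simp add: \<psi>_def)
  qed

  have claim: "u (a, t1) \<le> \<psi> \<epsilon> a t1" if \<epsilon>: "0 < \<epsilon>" "\<epsilon> < d\<^sup>2" for \<epsilon>
  proof -
    have "sqrt \<epsilon> < d" using \<epsilon> d(1) by (metis real_sqrt_less_iff real_sqrt_abs abs_of_pos)
    have "\<forall>\<^sub>F t in at_right 0. I t < ?V (sqrt \<epsilon>) \<and> t \<in> {0<..<t1}"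
      using I_small[of "sqrt \<epsilon>"] eventually_at_right_real[OF t1(1)] \<epsilon>(1) by (auto intro: eventually_conj)
    then obtain t0 where t0: "I t0 < ?V (sqrt \<epsilon>)" "0 < t0" "t0 < t1"
      using eventually_happens[of _ "at_right (0::real)"] by fastforce
    have q1: "(norm (z - a))\<^sup>2 + \<epsilon> < 1" "0 < (norm (z - a))\<^sup>2 + \<epsilon>" if "z \<in> cball a d" for z
    proof -
      have "(norm (z - a))\<^sup>2 \<le> d\<^sup>2" using that by (intro power_mono) (auto simp: dist_norm norm_minus_commute)
      moreover have "d\<^sup>2 < (1/4)\<^sup>2" using d by (intro power_strict_mono) auto
      ultimately show "(norm (z - a))\<^sup>2 + \<epsilon> < 1" using \<epsilon> by (simp add: power2_eq_square)
    qed (use \<epsilon> in \<open>simp add: add_nonneg_pos\<close>)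
    let ?K = "cball a d \<times> {t0..t1}"
    let ?v = "\<lambda>(z, t). u (z, t) - \<psi> \<epsilon> z t"
    have "continuous_on ?K u"
      using cball_\<Omega> closure_subset[of \<Omega>] t0 t1 by (intro continuous_on_subset[OF u_cont]) force
    then have "continuous_on ?K ?v"
      unfolding \<psi>_def \<kappa>_def case_prod_beta by (intro continuous_intros) (use q1(2) in force)+
    then have "\<exists>x\<in>?K. \<forall>y\<in>?K. ?v y \<le> ?v x"
      using d(1) t0 by (intro continuous_attains_sup compact_Times) auto
    then obtain z t where z: "z \<in> cball a d" and t: "t0 \<le> t" "t \<le> t1"
      and max: "\<And>y s. y \<in> cball a d \<Longrightarrow> t0 \<le> s \<Longrightarrow> s \<le> t1 \<Longrightarrow> u (y, s) - \<psi> \<epsilon> y s \<le> u (z, t) - \<psi> \<epsilon> z t"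
      by force
    have t': "0 < t" "t \<in> {0<..<T}" using t t0 t1 by auto
    define q where "q = (norm (z - a))\<^sup>2 + \<epsilon>"
    have q: "0 < q" "q < 1" using q1[OF z] by (auto simp: q_def)
    note \<psi>_z = \<psi>_ge[OF \<epsilon>(1) q1(1)[OF z] less_imp_le[OF t'(1)] t(2), folded q_def]
    have "u (z, t) \<le> \<psi> \<epsilon> z t"
    proof (rule ccontr)
      assume "\<not> ?thesis"
      then have pos: "\<psi> \<epsilon> z t < u (z, t)" by simp
      have "t \<noteq> t0"
      proof
        assume "t = t0"
        have "u (z, t) \<le> C + \<nu> * ln (dist z a + sqrt \<epsilon>) + 1"
          using \<open>sqrt \<epsilon> < d\<close> \<epsilon> t0(1) \<open>t = t0\<close> by (intro u_le z t'(2)) auto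
        also have "\<nu> * ln (dist z a + sqrt \<epsilon>) \<le> \<nu> * (ln (2 * q) / 2)"
        proof (intro mult_left_mono)
          have s: "0 < dist z a + sqrt \<epsilon>" using \<epsilon> by (simp add: add_nonneg_pos)
          have "(dist z a + sqrt \<epsilon>)\<^sup>2 \<le> 2 * q"
            using \<epsilon> sum_squares_ge_zero[of "dist z a - sqrt \<epsilon>" 0]
            by (simp add: q_def dist_norm power2_eq_square algebra_simps)
          then have "ln ((dist z a + sqrt \<epsilon>)\<^sup>2) \<le> ln (2 * q)" using s by (intro ln_mono) auto
          then show "ln (dist z a + sqrt \<epsilon>) \<le> ln (2 * q) / 2" using s by (simp add: ln_realpow)
        qed (use \<nu> in simp)
        finally have "u (z, t) \<le> C + \<nu> / 2 * ln 2 + \<nu> / 2 * ln q + 1" using q by (simp add: ln_mult algebra_simps add_divide_distrib)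
        also have "\<dots> \<le> \<nu> / 2 * ln q + C0" using C0_ge(1) by linarith
        finally show False using \<psi>_z pos by simp
      qed
      then have "t0 < t" using t by simp
      have "dist z a \<noteq> d"
      proof
        assume "dist z a = d"
        have "u (z, t) \<le> C + \<nu> * ln (d + d) + 1"
          using u_le[OF z d(1) order_refl t'(2)] t1'(2)[of t] t' t t1 \<open>dist z a = d\<close> by (simp add: less_imp_le)
        also have "\<dots> \<le> C + 1" using d \<nu> by (simp add: mult_nonneg_nonpos)
        finally have "u (z, t) \<le> C + 1" .
        moreover have "ln (d\<^sup>2) \<le> ln q" using \<open>dist z a = d\<close> \<epsilon> d by (intro ln_mono) (auto simp: q_def dist_norm)
        then have "\<nu> * ln d \<le> \<nu> / 2 * ln q" using \<nu> d by (simp add: ln_realpow mult_left_mono)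
        then have "C + 1 \<le> \<nu> / 2 * ln q + C0" using C0_ge(2) by linarith
        ultimately show False using \<psi>_z pos by simp
      qed
      then have "dist a z < d" using z by (simp add: dist_commute)
      have "z \<in> closure \<Omega>" using z cball_\<Omega> closure_subset by blast
      define D where "D = ln (Re (det (complex_hessian (\<lambda>w. u (w, t)) z))) - A * u (z, t) + f (z, t)"
      have "ln (Re (det (complex_hessian (\<lambda>w. u (w, t)) z))) \<le> C1 - ?n * ln q"
        unfolding C1_def q_def
      proof (rule ln_det_hessian_le_of_touching[OF u_spsh[OF t'(2)] \<open>z \<in> closure \<Omega>\<close>, of "d - dist a z"])
        show "0 < \<kappa> t" "\<kappa> t \<le> \<nu>" using \<kappa>[of t] t t' by auto
        fix x assume "x \<in> ball z (d - dist a z)"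
        then have "x \<in> cball a d" using dist_triangle[of a x z] by simp
        from max[OF this t] show "u (x, t) \<le> u (z, t) + \<kappa> t / 2 * (ln ((norm (x - a))\<^sup>2 + \<epsilon>) - ln ((norm (z - a))\<^sup>2 + \<epsilon>))"
          by (simp add: \<psi>_def algebra_simps)
      qed (use \<open>dist a z < d\<close> \<epsilon> q1(1)[OF z] in auto)
      moreover have "- (A * u (z, t)) \<le> - (A * (\<nu> / 2 * ln q))"
      proof -
        have "\<nu> / 2 * ln q \<le> u (z, t)" using \<psi>_z pos \<open>0 \<le> C0\<close> by linarith
        from mult_left_mono[OF this assms(1)] show ?thesis by simp
      qed
      moreover have "f (z, t) \<le> F" using F[OF \<open>z \<in> closure \<Omega>\<close>] t' by simp
      moreover have "c / 2 * ln q = ?n * ln q + A * (\<nu> / 2 * ln q)" by (simp add: c_def algebra_simps add_divide_distrib)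
      ultimately have "D \<le> C1 + F - c / 2 * ln q" unfolding D_def by linarith
      then have "D - (- c / 2 * ln q + C2) < 0" by (simp add: C2_def)
      moreover have "((\<lambda>s. u (z, s) - \<psi> \<epsilon> z s) has_real_derivative D - (- c / 2 * ln q + C2)) (at t)"
        unfolding \<psi>_def \<kappa>_def q_def[symmetric]
        by (auto intro!: derivative_eq_intros u_eq[OF \<open>z \<in> closure \<Omega>\<close> t'(2), folded D_def])
      ultimately obtain \<delta> where \<delta>: "0 < \<delta>"
        "\<And>h. 0 < h \<Longrightarrow> h < \<delta> \<Longrightarrow> u (z, t) - \<psi> \<epsilon> z t < u (z, t - h) - \<psi> \<epsilon> z (t - h)"
        using DERIV_neg_dec_left by blast
      define h where "h = min \<delta> (t - t0) / 2"
      have "0 < h" "h < \<delta>" "t0 \<le> t - h" using \<delta>(1) \<open>t0 < t\<close> by (auto simp: h_def min_def field_simps)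
      then show False using \<delta>(2)[of h] max[OF z, of "t - h"] t by simp
    qed
    then show ?thesis using max[of a t1] d(1) t0 by simp
  qed

  define B where "B = (u (a, t1) - C0 - C2 * t1 - 1) / (\<kappa> t1 / 2)"
  define \<epsilon> where "\<epsilon> = min (d\<^sup>2 / 2) (exp B)"
  have \<epsilon>: "0 < \<epsilon>" "\<epsilon> < d\<^sup>2"
  proof -
    have "0 < d\<^sup>2" using d(1) by simp
    then have "d\<^sup>2 / 2 < d\<^sup>2" by simp
    then show "\<epsilon> < d\<^sup>2" unfolding \<epsilon>_def by linarith
  qed (use d(1) in \<open>simp add: \<epsilon>_def\<close>)
  have "ln \<epsilon> \<le> ln (exp B)" using \<epsilon>(1) by (intro ln_mono) (simp_all add: \<epsilon>_def)
  then have "ln \<epsilon> \<le> B" by simp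
  then have "\<kappa> t1 / 2 * ln \<epsilon> \<le> u (a, t1) - C0 - C2 * t1 - 1"
    using \<kappa>[of t1] t1(1) by (simp add: B_def pos_le_divide_eq mult.commute)
  with claim[OF \<epsilon>] show False by (simp add: \<psi>_def)
qed

end
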